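(* Let $p\geq 1$, $q\geq 0$ be integers. Timelike geodesics in $\mathcal H^{p,q}$ are exactly the branches of hyperbola with center on $\partial\mathcal H^{p,q}$, which do not meet $\partial\mathcal H^{p,q}$, of eccentricity $$e_T(u,v)=\sqrt{1+\frac{\|u\|^2+\|v\|^2}{\|v\|^2-\|u\|^2}},$$ where $(u,v,w)$ is a vector tangent to the geodesic at any point. These are incomplete on both sides.
   Context: The half-space model is $\mathcal H^{p,q}=\{(x,y,z)\in\mathbb R^{p-1}\oplus\mathbb R^q\oplus\mathbb R : z>0\}$ with the pseudo-Riemannian metric $g_{p,q}=\frac{dx_1^2+\dots+dx_{p-1}^2-dy_1^2-\dots-dy_q^2+dz^2}{z^2}$; $\partial\mathcal H^{p,q}$ is the hyperplane $\{z=0\}$ in $\mathbb R^{p+q}$. $\|\cdot\|$ denotes the Euclidean norm on $\mathbb R^{p-1}$ and on $\mathbb R^q$. Tangent vectors are written $(u,v,w)$ with $u\in\mathbb R^{p-1}$, $v\in\mathbb R^q$, $w\in\mathbb R$. The eccentricity is computed with respect to the Euclidean distance of $\mathbb R^{p+q}\supset\mathcal H^{p,q}$. Geodesics are maximal and unparametrized, i.e. the statement is about the images of the parametrized curves. A geodesic is timelike if its tangent vectors are negative for $g_{p,q}$; if $(u,v,w)$ is tangent to a timelike curve, then necessarily $\|u\|<\|v\|$. A geodesic is complete on one side if it admits a parameterization (as a parametrized geodesic) defined on a half-open interval $[a,+\infty)$; for timelike geodesics this is equivalent to the integral of $\sqrt{|g_{p,q}(\gamma',\gamma')|}$ being infinite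 over the corresponding end. It is incomplete on that side otherwise.
   Formalization: The branches of hyperbola are also required to have only timelike tangent vectors (u,v,w), with (u,v) in one common direction at all points; without either condition, some branches with center on the boundary and eccentricity e_T(u,v) are not geodesics. *)

theory Defs
  imports "HOL-Analysis.Analysis"
begin

section \<open>Geodesics of a pseudo-Riemannian metric on an open subset of a coordinate space\<close>

text \<open>
  A metric is a function \<open>g\<close> taking a point and two tangent vectors at that point; its geodesics
  are those of the Levi-Civita connection, written in the coordinates of the ambient space.
\<close>

type_synonym 'n metric = "real ^ 'n \<Rightarrow> real ^ 'n \<Rightarrow> real ^ 'n \<Rightarrow> real"

definition gram :: "'n::finite metric \<Rightarrow> real ^ 'n \<Rightarrow> real ^ 'n ^ 'n" where
  "gram g x = (\<chi> i j. g x (axis i 1) (axis j 1))"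

definition gram_partial :: "'n::finite metric \<Rightarrow> real ^ 'n \<Rightarrow> 'n \<Rightarrow> 'n \<Rightarrow> 'n \<Rightarrow> real" where
  "gram_partial g x l i j = frechet_derivative (\<lambda>y. gram g y $ i $ j) (at x) (axis l 1)"

text \<open>The upper index of the Christoffel symbol is the last argument.\<close>

definition christoffel :: "'n::finite metric \<Rightarrow> real ^ 'n \<Rightarrow> 'n \<Rightarrow> 'n \<Rightarrow> 'n \<Rightarrow> real" where
  "christoffel g x i j m =
     (1/2) * (\<Sum>l\<in>UNIV. matrix_inv (gram g x) $ m $ l *
        (gram_partial g x i j l + gram_partial g x j i l - gram_partial g x l i j))"

text \<open>
  The interval \<open>I\<close> need not be open (derivatives at an endpoint are one-sided), but it must be
  nondegenerate, since derivatives within a singleton carry no information.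
\<close>

definition geodesic_on ::
    "'n::finite metric \<Rightarrow> (real ^ 'n) set \<Rightarrow> real set \<Rightarrow> (real \<Rightarrow> real ^ 'n) \<Rightarrow> bool" where
  "geodesic_on g U I \<gamma> \<longleftrightarrow>
     is_interval I \<and> (\<exists>s\<in>I. \<exists>t\<in>I. s < t) \<and> \<gamma> ` I \<subseteq> U \<and>
     (\<exists>\<gamma>' \<gamma>''. \<forall>t\<in>I.
        (\<gamma> has_vector_derivative \<gamma>' t) (at t within I) \<and>
        (\<gamma>' has_vector_derivative \<gamma>'' t) (at t within I) \<and>
        (\<forall>m. \<gamma>'' t $ m
              + (\<Sum>i\<in>UNIV. \<Sum>j\<in>UNIV. christoffel g (\<gamma> t) i j m * \<gamma>' t $ i * \<gamma>' t $ j) = 0))"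

definition maximal_geodesic_on ::
    "'n::finite metric \<Rightarrow> (real ^ 'n) set \<Rightarrow> real set \<Rightarrow> (real \<Rightarrow> real ^ 'n) \<Rightarrow> bool" where
  "maximal_geodesic_on g U I \<gamma> \<longleftrightarrow>
     geodesic_on g U I \<gamma> \<and>
     \<not> (\<exists>J \<delta>. I \<subset> J \<and> geodesic_on g U J \<delta> \<and> (\<forall>t\<in>I. \<delta> t = \<gamma> t))"

definition timelike_on ::
    "'n::finite metric \<Rightarrow> real set \<Rightarrow> (real \<Rightarrow> real ^ 'n) \<Rightarrow> bool" where
  "timelike_on g I \<gamma> \<longleftrightarrow>
     (\<forall>t\<in>I. let v = vector_derivative \<gamma> (at t within I) in g (\<gamma> t) v v < 0)"

text \<open>Unparametrized maximal timelike geodesics, as subsets of \<open>U\<close>.\<close>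

definition timelike_geodesic :: "'n::finite metric \<Rightarrow> (real ^ 'n) set \<Rightarrow> (real ^ 'n) set \<Rightarrow> bool" where
  "timelike_geodesic g U S \<longleftrightarrow>
     (\<exists>I \<gamma>. maximal_geodesic_on g U I \<gamma> \<and> timelike_on g I \<gamma> \<and> S = \<gamma> ` I)"

text \<open>
  Here \<open>R\<close> is one of the two rays into which a point cuts a maximal geodesic. Constant curves
  satisfy the geodesic equation and must be excluded as parametrizations.
\<close>

definition complete_ray :: "'n::finite metric \<Rightarrow> (real ^ 'n) set \<Rightarrow> (real ^ 'n) set \<Rightarrow> bool" where
  "complete_ray g U R \<longleftrightarrow>
     (\<exists>a \<delta>. geodesic_on g U {a..} \<delta> \<and> \<not> \<delta> constant_on {a..} \<and> \<delta> ` {a..} = R)"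

definition incomplete_on_both_sides ::
    "'n::finite metric \<Rightarrow> (real ^ 'n) set \<Rightarrow> (real ^ 'n) set \<Rightarrow> bool" where
  "incomplete_on_both_sides g U S \<longleftrightarrow>
     (\<forall>I \<gamma>. maximal_geodesic_on g U I \<gamma> \<and> \<gamma> ` I = S \<longrightarrow>
        (\<forall>t\<in>I. \<not> complete_ray g U (\<gamma> ` (I \<inter> {t..})) \<and>
               \<not> complete_ray g U (\<gamma> ` (I \<inter> {..t}))))"


section \<open>The half-space model\<close>

text \<open>
  The coordinates of \<open>real ^ 'n\<close> are split into the \<open>x\<close>-coordinates (indices in \<open>X\<close>), the
  \<open>y\<close>-coordinates (indices in \<open>Y\<close>) and the \<open>z\<close>-coordinate (index \<open>k\<close>). The signature is encoded by
  index sets, and not by a product of coordinate spaces, because \<open>X\<close> and \<open>Y\<close> may be empty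
  (\<open>p = 1\<close> or \<open>q = 0\<close>), whereas a type of indices may not.
\<close>

definition half_space :: "'n::finite \<Rightarrow> (real ^ 'n) set" where
  "half_space k = {x. x $ k > 0}"

definition half_space_boundary :: "'n::finite \<Rightarrow> (real ^ 'n) set" where
  "half_space_boundary k = {x. x $ k = 0}"

definition half_space_metric :: "'n::finite set \<Rightarrow> 'n set \<Rightarrow> 'n \<Rightarrow> 'n metric" where
  "half_space_metric X Y k x s t =
     ((\<Sum>i\<in>X. s $ i * t $ i) - (\<Sum>i\<in>Y. s $ i * t $ i) + s $ k * t $ k) / (x $ k)\<^sup>2"

text \<open>The part \<open>(u, v, 0)\<close> of \<open>(u, v, w)\<close>.\<close>

definition horizontal_part :: "'n::finite \<Rightarrow> real ^ 'n \<Rightarrow> real ^ 'n" where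
  "horizontal_part k t = t - (t $ k) *\<^sub>R axis k 1"

text \<open>
  For \<open>t = (u, v, w)\<close> the norms of \<open>u\<close> and \<open>v\<close> are the \<open>L2_set\<close> below. The formula is meaningful
  only if the norm of \<open>u\<close> is less than that of \<open>v\<close>, in particular if \<open>t\<close> is timelike.
\<close>

definition ecc_T :: "'n::finite set \<Rightarrow> 'n set \<Rightarrow> real ^ 'n \<Rightarrow> real" where
  "ecc_T X Y t =
     (let nu = L2_set (\<lambda>i. t $ i) X; nv = L2_set (\<lambda>i. t $ i) Y
      in sqrt (1 + (nu\<^sup>2 + nv\<^sup>2) / (nv\<^sup>2 - nu\<^sup>2)))"


section \<open>Hyperbolas and tangent vectors in Euclidean space\<close>

text \<open>
  One branch of the hyperbola with center \<open>c\<close> in the plane through \<open>c\<close> spanned by the orthonormal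
  pair \<open>a\<close>, \<open>b\<close>, with semi-axes \<open>A\<close> and \<open>B\<close>; the other branch is obtained by replacing \<open>a\<close> with \<open>- a\<close>.
  The eccentricity \<open>e\<close> is the distance from the center to a focus divided by \<open>A\<close>.
\<close>

definition hyperbola_branch :: "'a::euclidean_space \<Rightarrow> real \<Rightarrow> 'a set \<Rightarrow> bool" where
  "hyperbola_branch c e S \<longleftrightarrow>
     (\<exists>a b A B. norm a = 1 \<and> norm b = 1 \<and> a \<bullet> b = 0 \<and> A > 0 \<and> B > 0 \<and>
        e = sqrt (A\<^sup>2 + B\<^sup>2) / A \<and>
        S = {c + s *\<^sub>R a + t *\<^sub>R b | s t. s > 0 \<and> s\<^sup>2 / A\<^sup>2 - t\<^sup>2 / B\<^sup>2 = 1})"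

text \<open>Nonzero velocities at \<open>x\<close> of curves that stay in \<open>S\<close> near the parameter of \<open>x\<close>.\<close>

definition tangent_vector :: "'a::real_normed_vector set \<Rightarrow> 'a \<Rightarrow> 'a \<Rightarrow> bool" where
  "tangent_vector S x t \<longleftrightarrow>
     t \<noteq> 0 \<and>
     (\<exists>\<gamma>. \<gamma> 0 = x \<and> (\<forall>\<^sub>F s in nhds 0. \<gamma> s \<in> S) \<and> (\<gamma> has_vector_derivative t) (at (0::real)))"

text \<open>
  The branches of hyperbola of the classification. A tangent vector is written \<open>t = (u, v, w)\<close>.
  That the eccentricity is \<open>ecc_T\<close> of "a vector tangent at any point" is understood to involve one
  direction \<open>(u, v)\<close>, spanned by \<open>h\<close>, common to all points, and timelike tangent vectors.
  Neither condition follows from the others: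
  for \<open>p = q = 1\<close>, the branch \<open>z\<^sup>2 - y\<^sup>2 = 1\<close>, \<open>z > 0\<close> rotated by a small angle about the origin still
  has its center on the boundary, avoids the boundary and has eccentricity \<open>sqrt 2 = ecc_T X Y t\<close> for
  all its tangent vectors, but some of these are not timelike;
  for \<open>p = 1\<close>, \<open>q = 2\<close>, the rectangular hyperbola
  \<open>(sinh s, sin f * cosh s, cos f * cosh s)\<close> with \<open>0 < f < pi/2\<close>
  moreover has only timelike tangent vectors, but it lies in no vertical plane.
\<close>

definition timelike_hyperbola_branch ::
    "'n::finite set \<Rightarrow> 'n set \<Rightarrow> 'n \<Rightarrow> (real ^ 'n) set \<Rightarrow> bool" where
  "timelike_hyperbola_branch X Y k S \<longleftrightarrow>
     S \<subseteq> half_space k \<and> S \<inter> half_space_boundary k = {} \<and>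
     (\<exists>c e h. c \<in> half_space_boundary k \<and> hyperbola_branch c e S \<and>
        (\<forall>x\<in>S. \<forall>t. tangent_vector S x t \<longrightarrow>
            e = ecc_T X Y t \<and>
            horizontal_part k t \<in> span {h} \<and>
            half_space_metric X Y k x t t < 0))"

end

theory Submission
  imports Defs
begin

text \<open>
  Why the theorem is true. The metric is \<open>z\<^sup>-\<^sup>2\<close> times a flat one, and its geodesic equation, once the
  Christoffel symbols are computed (\<open>christoffel_sum\<close>), has two kinds of first integrals: the
  horizontal velocity divided by \<open>z\<^sup>2\<close> is a constant vector \<open>h\<^sub>0\<close>, because horizontal translations
  are isometries, and the squared speed is a constant \<open>- \<omega>\<^sup>2\<close>. The key remark is that in terms of
  \<open>\<rho> = 1 / z\<close> the equation for the height then becomes linear, \<open>\<rho>'' = - \<omega>\<^sup>2 \<rho>\<close>: a timelike geodesic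
  is governed by a harmonic oscillator. Hence \<open>\<rho>\<close> is a multiple of \<open>cos \<theta>\<close> with \<open>\<theta> = \<omega> (t - s)\<close>, the
  horizontal position is obtained by integrating \<open>1 / \<rho>\<^sup>2\<close>, and the geodesic is
  \<open>c + A tan \<theta> h + (A / cos \<theta>) e\<^sub>k\<close>, with \<open>h\<close> a multiple of \<open>h\<^sub>0\<close>
  (\<open>timelike_geodesic_normal_form\<close>). It lives as long as \<open>cos \<theta>\<close> is positive, that is, for the
  finite time \<open>pi / \<omega>\<close>, which is the incompleteness on both sides, and it traces the branch
  \<open>\<zeta>\<^sup>2 - \<sigma>\<^sup>2 = A\<^sup>2\<close> in the vertical plane with coordinates \<open>(\<sigma>, \<zeta>)\<close> relative to \<open>h\<close> and \<open>e\<^sub>k\<close>. Since \<open>h\<close> is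
  a unit vector for the indefinite form but in general not for the Euclidean one, this is a Euclidean hyperbola with
  semi-axes \<open>A\<close> and \<open>A * norm h\<close>, and its eccentricity is the one in the theorem
  (\<open>timelike_hyperbola_branch_vertical_branch\<close>).

  Conversely, a branch as in the theorem lies in a vertical plane, but its axes could a priori be
  tilted in that plane. Letting its points go to infinity shows that both asymptotic directions
  satisfy the weak timelike inequality. The eccentricity says that the angle between the asymptotes
  around the conjugate axis is the opening of the timelike cone of the plane. Two lines of the closed
  cone at this angle bound it, so that the conjugate axis is horizontal, unless the cone has a right
  angle and the asymptotes bound it with the axes exchanged; but then the vertex would be on the boundary
  (\<open>vertical_axis_of_asymptotes\<close>, \<open>vertical_branch_of_timelike_hyperbola_branch\<close>).

  Incompleteness is slightly more than the finite lifetime of one parametrization, since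
  a ray must not be complete for any parametrization. A non-constant geodesic inside such a branch has
  somewhere a non-zero velocity, tangent to the branch and therefore timelike, so that the normal form
  bounds its interval of definition (\<open>no_complete_ray_in_vertical_branch\<close>).
\<close>

section \<open>The geodesic equation in the half-space model\<close>

locale half_space_model =
  fixes X Y :: "'n::finite set" and k :: 'n
  assumes disjoint: "X \<inter> Y = {}" and height: "k \<notin> X \<union> Y" and cover: "X \<union> Y \<union> {k} = UNIV"
begin

abbreviation "\<g> \<equiv> half_space_metric X Y k"
abbreviation "\<H> \<equiv> half_space k"
abbreviation e\<^sub>k :: "real ^ 'n" where "e\<^sub>k \<equiv> axis k 1"

text \<open>
  For a tangent vector \<open>(u, v, w)\<close> this is \<open>\<parallel>v\<parallel>\<^sup>2 - \<parallel>u\<parallel>\<^sup>2\<close>, the denominator in the eccentricity; the vector is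
  timelike if and only if it exceeds \<open>w\<^sup>2\<close>.
\<close>

definition gap :: "real ^ 'n \<Rightarrow> real" where
  "gap v = (\<Sum>i\<in>Y. (v $ i)\<^sup>2) - (\<Sum>i\<in>X. (v $ i)\<^sup>2)"

definition metric_sign :: "'n \<Rightarrow> real" where
  "metric_sign i = (if i \<in> Y then -1 else 1)"

lemma metric_sign_k [simp]: "metric_sign k = 1"
  using height by (auto simp: metric_sign_def)

lemma metric_sign_mult_self [simp]: "metric_sign i * metric_sign i = 1"
  by (auto simp: metric_sign_def)

lemma sum_split: "sum f UNIV = sum f X + sum f Y + f k" for f :: "'n \<Rightarrow> real"
proof -
  have "sum f UNIV = sum f (insert k (X \<union> Y))"
    using cover by (metis Un_commute insert_is_Un)
  also have "\<dots> = f k + sum f (X \<union> Y)"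
    using height by simp
  also have "sum f (X \<union> Y) = sum f X + sum f Y"
    using disjoint by (intro sum.union_disjoint) auto
  finally show ?thesis by simp
qed

lemma metric_diag: "\<g> x v v = ((v $ k)\<^sup>2 - gap v) / (x $ k)\<^sup>2"
  by (simp add: half_space_metric_def gap_def power2_eq_square)

lemma sum_sign: "(\<Sum>i\<in>UNIV. metric_sign i * (v $ i)\<^sup>2) = (v $ k)\<^sup>2 - gap v"
proof -
  have "(\<Sum>i\<in>X. metric_sign i * (v $ i)\<^sup>2) = (\<Sum>i\<in>X. (v $ i)\<^sup>2)"
    using disjoint by (intro sum.cong) (auto simp: metric_sign_def)
  moreover have "(\<Sum>i\<in>Y. metric_sign i * (v $ i)\<^sup>2) = - (\<Sum>i\<in>Y. (v $ i)\<^sup>2)"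
    by (subst sum_negf [symmetric], intro sum.cong) (auto simp: metric_sign_def)
  ultimately show ?thesis
    by (simp add: sum_split gap_def)
qed

lemma gram_half_space:
  "gram \<g> x $ i $ j = (if i = j then metric_sign i / (x $ k)\<^sup>2 else 0)"
proof (cases "i = j")
  case True
  have "\<g> x (axis i 1) (axis i 1) = ((\<Sum>l\<in>UNIV. metric_sign l * ((axis i 1 :: real ^ 'n) $ l)\<^sup>2)) / (x $ k)\<^sup>2"
    by (simp only: metric_diag sum_sign)
  also have "(\<Sum>l\<in>UNIV. metric_sign l * ((axis i 1 :: real ^ 'n) $ l)\<^sup>2) = (\<Sum>l\<in>UNIV. if i = l then metric_sign l else 0)"
    by (intro sum.cong) (auto simp: axis_def)
  finally show ?thesis using True by (simp add: gram_def)
next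
  case False
  then have "(axis i 1 :: real ^ 'n) $ l * (axis j 1 :: real ^ 'n) $ l = 0" for l
    by (auto simp: axis_def)
  then have "\<g> x (axis i 1) (axis j 1) = 0"
    unfolding half_space_metric_def by (simp only: sum.neutral_const) simp
  then show ?thesis using False by (simp add: gram_def)
qed

lemma matrix_inv_gram:
  assumes "x $ k > 0"
  shows "matrix_inv (gram \<g> x) $ i $ j = (if i = j then metric_sign i * (x $ k)\<^sup>2 else 0)"
proof -
  define B :: "real ^ 'n ^ 'n" where "B = (\<chi> i j. if i = j then metric_sign i * (x $ k)\<^sup>2 else 0)"
  let ?G = "gram \<g> x"
  have GB: "?G ** B = mat 1" and BG: "B ** ?G = mat 1"
    using assms by (auto simp: vec_eq_iff matrix_matrix_mult_def gram_half_space B_def mat_def mult_delta_left)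
  have "?G ** matrix_inv ?G = mat 1 \<and> matrix_inv ?G ** ?G = mat 1"
    unfolding matrix_inv_def by (rule someI [of _ B]) (simp add: GB BG)
  then have "matrix_inv ?G = B"
    by (metis BG matrix_mul_assoc matrix_mul_lid matrix_mul_rid)
  then show ?thesis by (simp add: B_def)
qed

lemma gram_partial_half_space:
  assumes "x $ k > 0"
  shows "gram_partial \<g> x l i j
    = (if i = j then (if l = k then - 2 * metric_sign i / (x $ k) ^ 3 else 0) else 0)"
proof (cases "i = j")
  case True
  have "((\<lambda>y. gram \<g> y $ i $ j) has_derivative (\<lambda>h. - 2 * metric_sign i / (x $ k) ^ 3 * h $ k)) (at x)"
    unfolding gram_half_space using True assms
    by (auto intro!: derivative_eq_intros bounded_linear.has_derivative [OF bounded_linear_vec_nth]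
        simp: field_simps power2_eq_square power3_eq_cube fun_eq_iff)
  from frechet_derivative_at [OF this, symmetric] True show ?thesis
    by (simp add: gram_partial_def axis_def)
next
  case False
  then show ?thesis by (simp add: gram_partial_def gram_half_space)
qed

text \<open>
  The geodesic equation solved for the second derivative. The general formula
  \<open>- \<Sum> \<Gamma> v v\<close> reduces to this because the metric is \<open>z\<^sup>-\<^sup>2\<close> times a constant diagonal one, so that only
  derivatives of its diagonal entries in the direction of \<open>z\<close> contribute.
\<close>

definition acceleration :: "real ^ 'n \<Rightarrow> real ^ 'n \<Rightarrow> real ^ 'n" where
  "acceleration x v = (1 / x $ k) *\<^sub>R ((2 * v $ k) *\<^sub>R v - ((v $ k)\<^sup>2 - gap v) *\<^sub>R e\<^sub>k)"

lemma christoffel_sum: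
  assumes "x $ k > 0"
  shows "(\<Sum>i\<in>UNIV. \<Sum>j\<in>UNIV. christoffel \<g> x i j m * v $ i * v $ j) = - acceleration x v $ m"
proof -
  \<comment> \<open>The three partial derivatives in the Christoffel symbol are treated separately; the first two
    contribute equally, by symmetry in \<open>i\<close> and \<open>j\<close>, and the third one only to the vertical component.\<close>
  define P where "P l i j = (if i = j then (if l = k then - 2 * metric_sign i / (x $ k) ^ 3 else 0) else 0)" for l i j
  define c where "c = metric_sign m * (x $ k)\<^sup>2 / 2"
  have chr: "christoffel \<g> x i j m = c * (P i j m + P j i m - P m i j)" for i j
    unfolding christoffel_def matrix_inv_gram [OF assms] gram_partial_half_space [OF assms] P_def [symmetric] c_def
    by (simp add: mult_delta_left)
  have 1: "(\<Sum>i\<in>UNIV. \<Sum>j\<in>UNIV. P i j m * v $ i * v $ j) = - 2 * metric_sign m / (x $ k) ^ 3 * v $ k * v $ m"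
  proof -
    have "P i j m * v $ i * v $ j = (if j = m then (if i = k then - 2 * metric_sign m / (x $ k) ^ 3 * v $ k * v $ m else 0) else 0)" for i j
      by (simp add: P_def)
    then show ?thesis by (simp only: sum.delta finite UNIV_I if_True)
  qed
  have 2: "(\<Sum>i\<in>UNIV. \<Sum>j\<in>UNIV. P j i m * v $ i * v $ j) = - 2 * metric_sign m / (x $ k) ^ 3 * v $ k * v $ m"
    by (subst sum.swap) (subst 1 [symmetric], intro sum.cong refl, simp)
  have 3: "(\<Sum>i\<in>UNIV. \<Sum>j\<in>UNIV. P m i j * v $ i * v $ j)
      = (if m = k then - 2 / (x $ k) ^ 3 * ((v $ k)\<^sup>2 - gap v) else 0)"
  proof -
    have "P m i j * v $ i * v $ j = (if i = j then (if m = k then - 2 / (x $ k) ^ 3 * (metric_sign i * (v $ i)\<^sup>2) else 0) else 0)" for i j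
      by (simp add: P_def power2_eq_square)
    then have "(\<Sum>i\<in>UNIV. \<Sum>j\<in>UNIV. P m i j * v $ i * v $ j)
        = (\<Sum>i\<in>UNIV. (if m = k then - 2 / (x $ k) ^ 3 * (metric_sign i * (v $ i)\<^sup>2) else 0))"
      by (simp only: sum.delta' finite UNIV_I if_True)
    also have "\<dots> = (if m = k then - 2 / (x $ k) ^ 3 * ((v $ k)\<^sup>2 - gap v) else 0)"
      by (simp only: sum_sign [symmetric] sum_distrib_left) simp
    finally show ?thesis .
  qed
  have "(\<Sum>i\<in>UNIV. \<Sum>j\<in>UNIV. christoffel \<g> x i j m * v $ i * v $ j)
      = c * ((\<Sum>i\<in>UNIV. \<Sum>j\<in>UNIV. P i j m * v $ i * v $ j)
           + (\<Sum>i\<in>UNIV. \<Sum>j\<in>UNIV. P j i m * v $ i * v $ j)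
           - (\<Sum>i\<in>UNIV. \<Sum>j\<in>UNIV. P m i j * v $ i * v $ j))"
    unfolding chr sum.distrib [symmetric] sum_subtractf [symmetric] sum_distrib_left
    by (intro sum.cong refl) (simp add: algebra_simps)
  also have "\<dots> = - acceleration x v $ m"
    unfolding 1 2 3 using assms metric_sign_mult_self [of m]
    by (cases "m = k")
      (simp_all add: acceleration_def c_def axis_def field_simps power2_eq_square power3_eq_cube)
  finally show ?thesis .
qed

lemma geodesic_on_iff:
  "geodesic_on \<g> \<H> I \<gamma> \<longleftrightarrow>
     is_interval I \<and> (\<exists>s\<in>I. \<exists>t\<in>I. s < t) \<and> (\<forall>t\<in>I. \<gamma> t $ k > 0) \<and>
     (\<exists>\<gamma>'. \<forall>t\<in>I.
        (\<gamma> has_vector_derivative \<gamma>' t) (at t within I) \<and>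
        (\<gamma>' has_vector_derivative acceleration (\<gamma> t) (\<gamma>' t)) (at t within I))"
proof -
  have eq: "(\<forall>m. a $ m + (\<Sum>i\<in>UNIV. \<Sum>j\<in>UNIV. christoffel \<g> x i j m * v $ i * v $ j) = 0)
      \<longleftrightarrow> a = acceleration x v" if "x $ k > 0" for a x v
    unfolding christoffel_sum [OF that] by (auto simp: vec_eq_iff)
  show ?thesis
    unfolding geodesic_on_def half_space_def image_subset_iff mem_Collect_eq
    by (intro conj_cong refl ex_cong1) (auto simp: eq choice_iff' intro!: exI [of _ "\<lambda>t. acceleration (_ t) (_ t)"])
qed

end

section \<open>Calculus on intervals\<close>

lemma interval_not_isolated:
  fixes I :: "real set"
  assumes "is_interval I" "\<exists>s\<in>I. \<exists>t\<in>I. s < t" "x \<in> I"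
  shows "at x within I \<noteq> bot"
proof -
  have "x islimpt I"
    using assms by (intro connected_imp_perfect) (auto simp: is_interval_connected_1)
  then show ?thesis by (simp add: trivial_limit_within)
qed

lemma has_vector_derivative_combination:
  assumes "(f has_real_derivative f') (at t within T)" "(g has_real_derivative g') (at t within T)"
  shows "((\<lambda>t. c + f t *\<^sub>R a + g t *\<^sub>R b) has_vector_derivative f' *\<^sub>R a + g' *\<^sub>R b) (at t within T)"
  using has_vector_derivative_add [OF has_vector_derivative_add [OF has_vector_derivative_const
      has_vector_derivative_scaleR [OF assms(1) has_vector_derivative_const]]
      has_vector_derivative_scaleR [OF assms(2) has_vector_derivative_const], of c a b]
  by simp

lemma zero_derivative_imp_const:
  fixes f :: "real \<Rightarrow> 'a::real_normed_vector"
  assumes "is_interval I" "\<And>t. t \<in> I \<Longrightarrow> (f has_vector_derivative 0) (at t within I)" "s \<in> I" "t \<in> I"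
  shows "f s = f t"
  using has_derivative_zero_constant [of I f] assms is_interval_convex
  unfolding has_vector_derivative_def scaleR_zero_right by metis

text \<open>
  The difference of two solutions with the same initial data has vanishing energy
  \<open>d'\<^sup>2 + \<omega>\<^sup>2 d\<^sup>2\<close>, which is conserved.
\<close>

lemma harmonic_oscillator:
  fixes f :: "real \<Rightarrow> real"
  assumes I: "is_interval I" "t\<^sub>0 \<in> I" and "\<omega> > 0"
    and f: "\<And>t. t \<in> I \<Longrightarrow> (f has_real_derivative f' t) (at t within I)"
    and f': "\<And>t. t \<in> I \<Longrightarrow> (f' has_real_derivative - \<omega>\<^sup>2 * f t) (at t within I)"
    and init: "f t\<^sub>0 = R * cos (\<omega> * (t\<^sub>0 - s))" "f' t\<^sub>0 = - R * \<omega> * sin (\<omega> * (t\<^sub>0 - s))"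
    and "t \<in> I"
  shows "f t = R * cos (\<omega> * (t - s))"
proof -
  define d where "d t = f t - R * cos (\<omega> * (t - s))" for t
  define d' where "d' t = f' t + R * \<omega> * sin (\<omega> * (t - s))" for t
  have d: "(d has_real_derivative d' t) (at t within I)" if "t \<in> I" for t
    unfolding d_def d'_def by (auto intro!: derivative_eq_intros f that)
  have d': "(d' has_real_derivative - \<omega>\<^sup>2 * d t) (at t within I)" if "t \<in> I" for t
    unfolding d_def d'_def
    by (auto intro!: derivative_eq_intros f' that simp: algebra_simps power2_eq_square)
  have "((\<lambda>t. (d' t)\<^sup>2 + \<omega>\<^sup>2 * (d t)\<^sup>2) has_real_derivative 0) (at t within I)" if "t \<in> I" for t
    by (rule derivative_eq_intros refl d d' that)+ (simp add: algebra_simps)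
  note this [unfolded has_real_derivative_iff_has_vector_derivative]
  from zero_derivative_imp_const [OF I(1) this \<open>t \<in> I\<close> I(2)]
  have "(d' t)\<^sup>2 + (\<omega> * d t)\<^sup>2 = 0"
    using init by (simp add: d_def d'_def power_mult_distrib)
  then have "d t = 0"
    using \<open>\<omega> > 0\<close> by (simp add: sum_power2_eq_zero_iff)
  then show ?thesis by (simp add: d_def)
qed

section \<open>Explicit timelike geodesics\<close>

context half_space_model
begin

lemma gap_add_vertical [simp]: "gap (v + w *\<^sub>R e\<^sub>k) = gap v"
  and gap_scaleR: "gap (r *\<^sub>R v) = r\<^sup>2 * gap v"
proof -
  have "i \<in> X \<Longrightarrow> i \<noteq> k" "i \<in> Y \<Longrightarrow> i \<noteq> k" for i
    using height by auto
  then show "gap (v + w *\<^sub>R e\<^sub>k) = gap v"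
    by (auto simp: gap_def axis_def intro!: arg_cong2 [of _ _ _ _ "(-)"] sum.cong)
  show "gap (r *\<^sub>R v) = r\<^sup>2 * gap v"
    by (simp add: gap_def power_mult_distrib sum_distrib_left right_diff_distrib)
qed

text \<open>
  The span of \<open>h\<close> and the vertical direction is invariant under the geodesic equation; hence the
  geodesics remain in vertical planes.
\<close>

lemma acceleration_span:
  assumes "h $ k = 0" "gap h = 1"
  shows "acceleration x (p *\<^sub>R h + r *\<^sub>R e\<^sub>k)
    = (2 * p * r / x $ k) *\<^sub>R h + ((p\<^sup>2 + r\<^sup>2) / x $ k) *\<^sub>R e\<^sub>k"
proof -
  have "(p *\<^sub>R h + r *\<^sub>R e\<^sub>k) $ k = r"
    using assms by (simp add: axis_def)
  then show ?thesis
    using assms by (simp add: acceleration_def gap_scaleR algebra_simps power2_eq_square add_divide_distrib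
      flip: scaleR_add_left)
qed

text \<open>
  The general timelike geodesic: \<open>h\<close> is horizontal with \<open>gap h = 1\<close>, the speed is \<open>\<omega>\<close>, and at time \<open>s\<close>
  the geodesic passes through its lowest point, at height \<open>A\<close>.
\<close>

definition branch_geodesic :: "real ^ 'n \<Rightarrow> real \<Rightarrow> real ^ 'n \<Rightarrow> real \<Rightarrow> real \<Rightarrow> real \<Rightarrow> real ^ 'n" where
  "branch_geodesic c A h \<omega> s t
     = c + (A * tan (\<omega> * (t - s))) *\<^sub>R h + (A / cos (\<omega> * (t - s))) *\<^sub>R e\<^sub>k"

text \<open>
  The largest interval around \<open>s\<close> on which the cosine in the denominator of the height is positive.
\<close>

definition lifetime :: "real \<Rightarrow> real \<Rightarrow> real set" where
  "lifetime \<omega> s = {t. \<bar>\<omega> * (t - s)\<bar> < pi / 2}"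

text \<open>
  The image of \<open>branch_geodesic\<close>: in the \<open>(\<sigma>, \<zeta>)\<close>-plane, one component of the pseudo-sphere of radius \<open>A\<close> around
  \<open>c\<close> for the flat form \<open>\<zeta>\<^sup>2 - \<sigma>\<^sup>2\<close>.
\<close>

definition vertical_branch :: "real ^ 'n \<Rightarrow> real \<Rightarrow> real ^ 'n \<Rightarrow> (real ^ 'n) set" where
  "vertical_branch c A h = {c + \<sigma> *\<^sub>R h + \<zeta> *\<^sub>R e\<^sub>k | \<sigma> \<zeta>. \<zeta> > 0 \<and> \<zeta>\<^sup>2 = \<sigma>\<^sup>2 + A\<^sup>2}"

lemma lifetime_eq: "\<omega> > 0 \<Longrightarrow> lifetime \<omega> s = {s - pi / (2 * \<omega>) <..< s + pi / (2 * \<omega>)}"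
  unfolding lifetime_def abs_less_iff by (auto simp: field_simps)

lemma cos_lifetime: "t \<in> lifetime \<omega> s \<Longrightarrow> cos (\<omega> * (t - s)) > 0"
  unfolding lifetime_def by (intro cos_gt_zero_pi) auto

lemma geodesic_branch_geodesic:
  fixes s :: real
  assumes "c $ k = 0" "h $ k = 0" "gap h = 1" "A > 0" "\<omega> > 0"
  defines "G \<equiv> branch_geodesic c A h \<omega> s" and "J \<equiv> lifetime \<omega> s"
  shows "geodesic_on \<g> \<H> J G"
    and "\<And>t. t \<in> J \<Longrightarrow>
      \<g> (G t) (vector_derivative G (at t within J)) (vector_derivative G (at t within J)) = - \<omega>\<^sup>2"
proof -
  define C where "C t = cos (\<omega> * (t - s))" for t
  define S where "S t = sin (\<omega> * (t - s))" for t
  have Cpos: "C t > 0" if "t \<in> J" for t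
    using cos_lifetime that by (simp add: C_def J_def)
  have trig: "(S t)\<^sup>2 = 1 - (C t)\<^sup>2" for t
    by (simp add: C_def S_def sin_squared_eq)
  have dC: "(C has_real_derivative - \<omega> * S t) (at t within J)"
    and dS: "(S has_real_derivative \<omega> * C t) (at t within J)" for t
    unfolding C_def S_def by (auto intro!: derivative_eq_intros)
  define G' where "G' t = (A * \<omega> / (C t)\<^sup>2) *\<^sub>R h + (A * \<omega> * S t / (C t)\<^sup>2) *\<^sub>R e\<^sub>k" for t
  have G: "G t = c + (A * (S t / C t)) *\<^sub>R h + (A / C t) *\<^sub>R e\<^sub>k" for t
    by (simp add: G_def branch_geodesic_def C_def S_def tan_def)
  have Gk: "G t $ k = A / C t" and G'k: "G' t $ k = A * \<omega> * S t / (C t)\<^sup>2" for t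
    using assms(1,2) by (simp_all add: G G'_def axis_def)
  have gapG': "gap (G' t) = (A * \<omega> / (C t)\<^sup>2)\<^sup>2" for t
    using assms(3) by (simp add: G'_def gap_scaleR)
  have dG: "(G has_vector_derivative G' t) (at t within J)" if "t \<in> J" for t
  proof -
    note pos = Cpos [OF that]
    have "((\<lambda>t. A * (S t / C t)) has_real_derivative A * \<omega> * ((C t)\<^sup>2 + (S t)\<^sup>2) / (C t)\<^sup>2) (at t within J)"
      using pos by (auto intro!: derivative_eq_intros dC dS simp: field_simps power2_eq_square)
    moreover have "((\<lambda>t. A / C t) has_real_derivative A * \<omega> * S t / (C t)\<^sup>2) (at t within J)"
      using pos by (auto intro!: derivative_eq_intros dC dS simp: field_simps power2_eq_square)
    ultimately show ?thesis
      unfolding G G'_def trig by (intro has_vector_derivative_combination) simp_all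
  qed
  have dG': "(G' has_vector_derivative acceleration (G t) (G' t)) (at t within J)" if "t \<in> J" for t
  proof -
    note pos = Cpos [OF that]
    have 1: "((\<lambda>t. A * \<omega> / (C t)\<^sup>2) has_real_derivative 2 * A * \<omega>\<^sup>2 * S t / (C t) ^ 3) (at t within J)"
      using pos trig [of t]
      by (auto intro!: derivative_eq_intros dC dS simp: field_simps power2_eq_square power3_eq_cube)
    have 2: "((\<lambda>t. A * \<omega> * S t / (C t)\<^sup>2) has_real_derivative A * \<omega>\<^sup>2 * (2 * (S t)\<^sup>2 + (C t)\<^sup>2) / (C t) ^ 3) (at t within J)"
      using pos trig [of t]
      by (auto intro!: derivative_eq_intros dC dS simp: field_simps power2_eq_square power3_eq_cube)
    have "2 * (S t)\<^sup>2 + (C t)\<^sup>2 = 1 + (S t)\<^sup>2"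
      using trig [of t] by simp
    note 2 = 2 [unfolded this]
    have "(G' has_vector_derivative (2 * A * \<omega>\<^sup>2 * S t / (C t) ^ 3) *\<^sub>R h
        + (A * \<omega>\<^sup>2 * (1 + (S t)\<^sup>2) / (C t) ^ 3) *\<^sub>R e\<^sub>k) (at t within J)"
      unfolding G'_def using has_vector_derivative_combination [OF 1 2, of 0] by simp
    also have "(2 * A * \<omega>\<^sup>2 * S t / (C t) ^ 3) *\<^sub>R h
        + (A * \<omega>\<^sup>2 * (1 + (S t)\<^sup>2) / (C t) ^ 3) *\<^sub>R e\<^sub>k = acceleration (G t) (G' t)"
      unfolding G'_def acceleration_span [OF assms(2,3)] Gk using pos \<open>A > 0\<close>
      by (intro arg_cong2 [of _ _ _ _ "(+)"] arg_cong2 [of _ _ _ _ scaleR] refl)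
        (auto simp: field_simps power2_eq_square power3_eq_cube)
    finally show ?thesis .
  qed
  have J: "is_interval J" "\<exists>s\<in>J. \<exists>t\<in>J. s < t"
  proof -
    show "is_interval J"
      using \<open>\<omega> > 0\<close> by (simp add: J_def lifetime_eq)
    have "s \<in> J" "s + pi / (4 * \<omega>) \<in> J" "s < s + pi / (4 * \<omega>)"
      using \<open>\<omega> > 0\<close> by (auto simp: J_def lifetime_def)
    then show "\<exists>s\<in>J. \<exists>t\<in>J. s < t" by blast
  qed
  show "geodesic_on \<g> \<H> J G"
    unfolding geodesic_on_iff using J dG dG' Cpos \<open>A > 0\<close> by (auto simp: Gk intro!: exI [of _ G'])
  have "vector_derivative G (at t within J) = G' t" if "t \<in> J" for t
    by (rule vector_derivative_within [OF interval_not_isolated [OF J that] dG [OF that]])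
  moreover have "\<g> (G t) (G' t) (G' t) = - \<omega>\<^sup>2" if "t \<in> J" for t
    using Cpos [OF that] \<open>A > 0\<close>
    unfolding metric_diag gapG' Gk G'k power_divide power_mult_distrib trig
    by (simp add: field_simps)
  ultimately show "\<g> (G t) (vector_derivative G (at t within J)) (vector_derivative G (at t within J)) = - \<omega>\<^sup>2"
    if "t \<in> J" for t
    using that by simp
qed

lemma branch_geodesic_image:
  assumes "A > 0" "\<omega> > 0"
  shows "branch_geodesic c A h \<omega> s ` lifetime \<omega> s = vertical_branch c A h"
proof (intro equalityI subsetI)
  fix x assume "x \<in> branch_geodesic c A h \<omega> s ` lifetime \<omega> s"
  then obtain t where t: "t \<in> lifetime \<omega> s" "x = branch_geodesic c A h \<omega> s t" by blast
  note pos = cos_lifetime [OF t(1)]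
  have "(A / cos (\<omega> * (t - s)))\<^sup>2 = (A * tan (\<omega> * (t - s)))\<^sup>2 + A\<^sup>2"
    using pos by (simp add: tan_def field_simps power_mult_distrib power_divide sin_squared_eq)
  then show "x \<in> vertical_branch c A h"
    using pos \<open>A > 0\<close> unfolding vertical_branch_def t(2) branch_geodesic_def
    by (intro CollectI exI conjI refl) auto
next
  fix x assume "x \<in> vertical_branch c A h"
  then obtain \<sigma> \<zeta> where x: "x = c + \<sigma> *\<^sub>R h + \<zeta> *\<^sub>R e\<^sub>k" "\<zeta> > 0" "\<zeta>\<^sup>2 = \<sigma>\<^sup>2 + A\<^sup>2"
    unfolding vertical_branch_def by blast
  define t where "t = s + arctan (\<sigma> / A) / \<omega>"
  have \<theta>: "\<omega> * (t - s) = arctan (\<sigma> / A)"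
    using assms by (simp add: t_def)
  have "t \<in> lifetime \<omega> s"
    using arctan_bounded [of "\<sigma> / A"] unfolding lifetime_def mem_Collect_eq \<theta> by linarith
  moreover have "A / cos (\<omega> * (t - s)) = \<zeta>"
  proof -
    have "sqrt (1 + (\<sigma> / A)\<^sup>2) = \<zeta> / A"
      using x assms by (intro real_sqrt_unique) (auto simp: field_simps power_divide)
    then show ?thesis using assms x unfolding \<theta> cos_arctan by simp
  qed
  ultimately show "x \<in> branch_geodesic c A h \<omega> s ` lifetime \<omega> s"
    using assms by (auto simp: x(1) branch_geodesic_def \<theta> tan_arctan intro!: image_eqI [of _ _ t])
qed

section \<open>Integration of the geodesic equation\<close>

text \<open>
  The geodesic equation is integrated explicitly, starting from one timelike velocity: the first
  integrals make \<open>1 / z\<close> a harmonic oscillator, and the rest is a quadrature. The conclusion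
  \<open>I \<subseteq> lifetime \<omega> s\<close> is what yields both the domain of the maximal geodesics and their incompleteness.
\<close>

lemma timelike_geodesic_normal_form:
  assumes geo: "geodesic_on \<g> \<H> I \<gamma>" and "t\<^sub>0 \<in> I"
    and v: "(\<gamma> has_vector_derivative v) (at t\<^sub>0 within I)"
    and "\<omega> > 0" and energy: "\<g> (\<gamma> t\<^sub>0) v v = - \<omega>\<^sup>2"
  obtains c A h s where "c $ k = 0" "h $ k = 0" "gap h = 1" "A > 0" "I \<subseteq> lifetime \<omega> s"
    "\<And>t. t \<in> I \<Longrightarrow> \<gamma> t = branch_geodesic c A h \<omega> s t"
proof -
  have I: "is_interval I" "t\<^sub>0 \<in> I" and pos: "\<And>t. t \<in> I \<Longrightarrow> \<gamma> t $ k > 0"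
    using geo \<open>t\<^sub>0 \<in> I\<close> by (auto simp: geodesic_on_iff)
  obtain \<gamma>' where d\<gamma>: "\<And>t. t \<in> I \<Longrightarrow> (\<gamma> has_vector_derivative \<gamma>' t) (at t within I)"
    and d\<gamma>': "\<And>t. t \<in> I \<Longrightarrow> (\<gamma>' has_vector_derivative acceleration (\<gamma> t) (\<gamma>' t)) (at t within I)"
    using geo by (auto simp: geodesic_on_iff)
  have "v = \<gamma>' t\<^sub>0"
    using geo I(2) by (intro vector_derivative_unique_within [OF _ v d\<gamma>] interval_not_isolated)
      (auto simp: geodesic_on_iff)
  note energy = energy [unfolded this]
  define z w where "z t = \<gamma> t $ k" and "w t = \<gamma>' t $ k" for t
  have z: "z t > 0" if "t \<in> I" for t using pos that by (simp add: z_def)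
  have dz: "(z has_real_derivative w t) (at t within I)" if "t \<in> I" for t
    unfolding z_def w_def has_real_derivative_iff_has_vector_derivative
    by (rule bounded_linear.has_vector_derivative [OF bounded_linear_vec_nth d\<gamma> [OF that]])
  have d\<gamma>'_nth: "((\<lambda>t. \<gamma>' t $ m) has_real_derivative acceleration (\<gamma> t) (\<gamma>' t) $ m) (at t within I)"
    if "t \<in> I" for t m
    unfolding has_real_derivative_iff_has_vector_derivative
    by (rule bounded_linear.has_vector_derivative [OF bounded_linear_vec_nth d\<gamma>' [OF that]])
  have acc: "acceleration (\<gamma> t) (\<gamma>' t) $ m = 2 * w t * \<gamma>' t $ m / z t" if "m \<noteq> k" for m t
    using that by (simp add: acceleration_def z_def w_def axis_def)
  \<comment> \<open>The conserved momentum of the horizontal translations, up to the signs of the metric.\<close>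
  define h\<^sub>0 where "h\<^sub>0 = (1 / (z t\<^sub>0)\<^sup>2) *\<^sub>R (\<gamma>' t\<^sub>0 - w t\<^sub>0 *\<^sub>R e\<^sub>k)"
  define n where "n = gap h\<^sub>0"
  have h\<^sub>0k: "h\<^sub>0 $ k = 0" by (simp add: h\<^sub>0_def w_def axis_def)
  have \<gamma>': "\<gamma>' t = (z t)\<^sup>2 *\<^sub>R h\<^sub>0 + w t *\<^sub>R e\<^sub>k" if "t \<in> I" for t
  proof -
    have "\<gamma>' t $ m = ((z t)\<^sup>2 *\<^sub>R h\<^sub>0 + w t *\<^sub>R e\<^sub>k) $ m" for m
    proof (cases "m = k")
      case True
      then show ?thesis by (simp add: h\<^sub>0k) (simp add: w_def axis_def)
    next
      case False
      have "((\<lambda>t. \<gamma>' t $ m / (z t)\<^sup>2) has_real_derivative 0) (at t within I)" if "t \<in> I" for t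
        using z [OF that]
        by (auto intro!: derivative_eq_intros d\<gamma>'_nth dz that
            simp: acc [OF False] field_simps power2_eq_square)
      note this [unfolded has_real_derivative_iff_has_vector_derivative]
      from zero_derivative_imp_const [OF I(1) this that I(2)]
      show ?thesis using False z [OF that] by (simp add: h\<^sub>0_def axis_def field_simps)
    qed
    then show ?thesis by (simp add: vec_eq_iff)
  qed
  have gap\<gamma>': "gap (\<gamma>' t) = n * z t ^ 4" if "t \<in> I" for t
    using \<gamma>' [OF that] by (simp add: gap_scaleR n_def)
  have dw: "(w has_real_derivative ((w t)\<^sup>2 + n * z t ^ 4) / z t) (at t within I)" if "t \<in> I" for t
  proof -
    have "acceleration (\<gamma> t) (\<gamma>' t) $ k = ((w t)\<^sup>2 + n * z t ^ 4) / z t"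
      using gap\<gamma>' [OF that] by (simp add: acceleration_def flip: z_def w_def) (simp add: axis_def power2_eq_square)
    with d\<gamma>'_nth [OF that, of k] show ?thesis by (simp add: w_def [abs_def])
  qed
  have first_integral: "n * (z t)\<^sup>2 - (w t)\<^sup>2 / (z t)\<^sup>2 = \<omega>\<^sup>2" if "t \<in> I" for t
  proof -
    have "((\<lambda>t. n * (z t)\<^sup>2 - (w t)\<^sup>2 / (z t)\<^sup>2) has_real_derivative 0) (at t within I)" if "t \<in> I" for t
      using z [OF that]
      by (auto intro!: derivative_eq_intros dz dw that simp: field_simps power2_eq_square power4_eq_xxxx)
    note this [unfolded has_real_derivative_iff_has_vector_derivative]
    from zero_derivative_imp_const [OF I(1) this that I(2)]
    have "n * (z t)\<^sup>2 - (w t)\<^sup>2 / (z t)\<^sup>2 = n * (z t\<^sub>0)\<^sup>2 - (w t\<^sub>0)\<^sup>2 / (z t\<^sub>0)\<^sup>2" .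
    also have "\<dots> = \<omega>\<^sup>2"
      using energy gap\<gamma>' [OF I(2)] z [OF I(2)]
      by (simp add: metric_diag flip: z_def w_def) (simp add: field_simps power2_eq_square power4_eq_xxxx)
    finally show ?thesis .
  qed
  have "n > 0"
  proof -
    have "n * (z t\<^sub>0)\<^sup>2 = \<omega>\<^sup>2 + (w t\<^sub>0)\<^sup>2 / (z t\<^sub>0)\<^sup>2"
      using first_integral [OF I(2)] by simp
    also have "\<dots> > 0" using \<open>\<omega> > 0\<close> by (intro add_pos_nonneg) auto
    finally show ?thesis by (simp add: zero_less_mult_iff)
  qed
  \<comment> \<open>The amplitude of \<open>1 / z\<close> is \<open>1 / A\<close>, as \<open>(1 / z)'\<^sup>2 + \<omega>\<^sup>2 (1 / z)\<^sup>2 = n\<close> by the conservation of speed.\<close>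
  define A where "A = \<omega> / sqrt n"
  have "A > 0" using \<open>n > 0\<close> \<open>\<omega> > 0\<close> by (simp add: A_def)
  have n: "n = \<omega>\<^sup>2 / A\<^sup>2" using \<open>n > 0\<close> \<open>\<omega> > 0\<close> by (simp add: A_def power_divide)
  \<comment> \<open>The phase at \<open>t\<^sub>0\<close>: the value and the derivative of \<open>1 / z\<close> there prescribe its cosine and sine. As the cosine is positive, the phase is an arcsine.\<close>
  define q where "q = A * w t\<^sub>0 / (\<omega> * (z t\<^sub>0)\<^sup>2)"
  define \<phi> where "\<phi> = arcsin q"
  define s where "s = t\<^sub>0 - \<phi> / \<omega>"
  have \<phi>: "\<omega> * (t\<^sub>0 - s) = \<phi>" using \<open>\<omega> > 0\<close> by (simp add: s_def)
  have w\<^sub>0: "(w t\<^sub>0)\<^sup>2 = (\<omega> * (z t\<^sub>0)\<^sup>2 / A)\<^sup>2 - (\<omega> * z t\<^sub>0)\<^sup>2"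
    using first_integral [OF I(2)] z [OF I(2)] \<open>A > 0\<close> unfolding n
    by (simp add: field_simps power2_eq_square)
  have sq: "q\<^sup>2 = 1 - (A / z t\<^sub>0)\<^sup>2"
    using z [OF I(2)] \<open>A > 0\<close> \<open>\<omega> > 0\<close> unfolding q_def power_divide power_mult_distrib w\<^sub>0
    by (simp add: field_simps)
  have "q\<^sup>2 < 1"
    unfolding sq using z [OF I(2)] \<open>A > 0\<close> by simp
  then have q: "- 1 < q" "q < 1"
    by (auto simp: abs_square_less_1 abs_less_iff)
  have \<phi>_bound: "\<bar>\<phi>\<bar> < pi / 2"
    using arcsin_lt_bounded [OF q] unfolding \<phi>_def by linarith
  have sin\<phi>: "sin \<phi> = q" and cos\<phi>: "cos \<phi> = A / z t\<^sub>0"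
    using q z [OF I(2)] \<open>A > 0\<close> by (simp_all add: \<phi>_def cos_arcsin sq del: power_divide)
  have inv_z: "1 / z t = 1 / A * cos (\<omega> * (t - s))" if "t \<in> I" for t
  proof (rule harmonic_oscillator [OF I \<open>\<omega> > 0\<close> _ _ _ _ that])
    fix t assume "t \<in> I"
    note zt = z [OF this]
    show "((\<lambda>t. 1 / z t) has_real_derivative - w t / (z t)\<^sup>2) (at t within I)"
      using zt by (auto intro!: derivative_eq_intros dz \<open>t \<in> I\<close> simp: power2_eq_square)
    have "((\<lambda>t. - w t / (z t)\<^sup>2) has_real_derivative ((w t)\<^sup>2 - n * z t ^ 4) / (z t) ^ 3) (at t within I)"
      using zt by (auto intro!: derivative_eq_intros dz dw \<open>t \<in> I\<close>
          simp: field_simps power2_eq_square power3_eq_cube power4_eq_xxxx)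
    also have "((w t)\<^sup>2 - n * z t ^ 4) / (z t) ^ 3 = - \<omega>\<^sup>2 * (1 / z t)"
      unfolding first_integral [OF \<open>t \<in> I\<close>, symmetric] using zt
      by (simp add: field_simps power2_eq_square power3_eq_cube power4_eq_xxxx)
    finally show "((\<lambda>t. - w t / (z t)\<^sup>2) has_real_derivative - \<omega>\<^sup>2 * (1 / z t)) (at t within I)" .
  next
    show "1 / z t\<^sub>0 = 1 / A * cos (\<omega> * (t\<^sub>0 - s))"
      "- w t\<^sub>0 / (z t\<^sub>0)\<^sup>2 = - (1 / A) * \<omega> * sin (\<omega> * (t\<^sub>0 - s))"
      using \<open>A > 0\<close> \<open>\<omega> > 0\<close> z [OF I(2)] by (simp_all add: \<phi> sin\<phi> cos\<phi> q_def)
  qed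
  have cos_pos: "cos (\<omega> * (t - s)) > 0" if "t \<in> I" for t
    using inv_z [OF that] z [OF that] \<open>A > 0\<close>
    by (metis zero_less_divide_iff zero_less_mult_iff zero_less_one order_less_asym)
  have z_eq: "z t = A / cos (\<omega> * (t - s))" if "t \<in> I" for t
    using inv_z [OF that] z [OF that] \<open>A > 0\<close> cos_pos [OF that] by (simp add: field_simps)
  have t\<^sub>0: "t\<^sub>0 \<in> lifetime \<omega> s"
    unfolding lifetime_def mem_Collect_eq \<phi> by (rule \<phi>_bound)
  have "I \<subseteq> lifetime \<omega> s"
  proof
    fix t assume "t \<in> I"
    show "t \<in> lifetime \<omega> s"
    proof (rule ccontr)
      assume "t \<notin> lifetime \<omega> s"
      \<comment> \<open>An interval that contains \<open>t\<^sub>0\<close> and leaves the lifetime contains an end of it, where the cosine vanishes.\<close>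
      then have "s + pi / (2 * \<omega>) \<le> t \<or> t \<le> s - pi / (2 * \<omega>)"
        unfolding lifetime_eq [OF \<open>\<omega> > 0\<close>] by auto
      moreover have "s - pi / (2 * \<omega>) < t\<^sub>0" "t\<^sub>0 < s + pi / (2 * \<omega>)"
        using t\<^sub>0 unfolding lifetime_eq [OF \<open>\<omega> > 0\<close>] by auto
      ultimately have "s + pi / (2 * \<omega>) \<in> I \<or> s - pi / (2 * \<omega>) \<in> I"
        using I \<open>t \<in> I\<close> unfolding is_interval_1 by (meson less_imp_le)
      then show False
        using cos_pos [of "s + pi / (2 * \<omega>)"] cos_pos [of "s - pi / (2 * \<omega>)"] \<open>\<omega> > 0\<close> by auto
    qed
  qed
  define h where "h = (A / \<omega>) *\<^sub>R h\<^sub>0"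
  have h: "h $ k = 0" "gap h = 1"
    using h\<^sub>0k n \<open>A > 0\<close> \<open>\<omega> > 0\<close> by (simp_all add: h_def gap_scaleR power_divide flip: n_def)
  define c where "c t = \<gamma> t - ((A * tan (\<omega> * (t - s))) *\<^sub>R h + z t *\<^sub>R e\<^sub>k)" for t
  have "(c has_vector_derivative 0) (at t within I)" if "t \<in> I" for t
  proof -
    note cos_pos [OF that]
    have "((\<lambda>t. A * tan (\<omega> * (t - s))) has_real_derivative A * \<omega> / (cos (\<omega> * (t - s)))\<^sup>2) (at t within I)"
      using cos_pos [OF that] by (auto intro!: derivative_eq_intros simp: field_simps)
    from has_vector_derivative_diff [OF d\<gamma> has_vector_derivative_combination [OF this dz, of 0]] that
    have "(c has_vector_derivative
        \<gamma>' t - ((A * \<omega> / (cos (\<omega> * (t - s)))\<^sup>2) *\<^sub>R h + w t *\<^sub>R e\<^sub>k)) (at t within I)"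
      by (simp add: c_def [abs_def])
    moreover have "(z t)\<^sup>2 *\<^sub>R h\<^sub>0 = (A * \<omega> / (cos (\<omega> * (t - s)))\<^sup>2) *\<^sub>R h"
      using \<open>\<omega> > 0\<close> by (simp add: z_eq [OF that] h_def power2_eq_square)
    ultimately show ?thesis by (simp add: \<gamma>' [OF that])
  qed
  then have const: "c t = c t\<^sub>0" if "t \<in> I" for t
    using zero_derivative_imp_const [OF I(1) _ that I(2)] by blast
  have "\<gamma> t = branch_geodesic (c t\<^sub>0) A h \<omega> s t" if "t \<in> I" for t
    unfolding branch_geodesic_def const [OF that, symmetric] z_eq [OF that, symmetric]
    by (simp add: c_def)
  moreover have "c t\<^sub>0 $ k = 0"
    using h by (simp add: c_def z_def axis_def)
  ultimately show ?thesis
    using that h \<open>A > 0\<close> \<open>I \<subseteq> lifetime \<omega> s\<close> by blast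
qed

section \<open>Tangent vectors and incompleteness\<close>

text \<open>
  Differentiating \<open>\<zeta>\<^sup>2 = \<sigma>\<^sup>2 + A\<^sup>2\<close> along the curve gives \<open>\<zeta> w = \<sigma> p\<close>, and \<open>\<bar>\<sigma>\<bar> < \<zeta>\<close> on the branch. The domain \<open>T\<close> is
  arbitrary because this is applied to two-sided derivatives of curves that stay in the branch only near a point
  as well as to geodesics on half-lines.
\<close>

lemma vertical_branch_velocity:
  assumes h: "h $ k = 0" "gap h = 1" and c: "c $ k = 0" and "A > 0"
    and \<gamma>: "\<gamma> ` T \<subseteq> vertical_branch c A h" "t \<in> T" "at t within T \<noteq> bot"
    and v: "(\<gamma> has_vector_derivative v) (at t within T)" "v \<noteq> 0"
  obtains p w where "v = p *\<^sub>R h + w *\<^sub>R e\<^sub>k" "w\<^sup>2 < p\<^sup>2"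
proof -
  have "h \<noteq> 0" using h by (auto simp: gap_def)
  \<comment> \<open>The horizontal coordinate is recovered linearly from the point, so that it is differentiable along the curve.\<close>
  define \<sigma> where "\<sigma> t = (\<gamma> t - c) \<bullet> h / (h \<bullet> h)" for t
  define p w where "p = v \<bullet> h / (h \<bullet> h)" and "w = v $ k"
  have on_branch: "\<gamma> t = c + \<sigma> t *\<^sub>R h + \<gamma> t $ k *\<^sub>R e\<^sub>k" "\<gamma> t $ k > 0" "(\<gamma> t $ k)\<^sup>2 = (\<sigma> t)\<^sup>2 + A\<^sup>2"
    if t: "t \<in> T" for t
  proof -
    obtain \<rho> \<zeta> where *: "\<gamma> t = c + \<rho> *\<^sub>R h + \<zeta> *\<^sub>R e\<^sub>k" "\<zeta> > 0" "\<zeta>\<^sup>2 = \<rho>\<^sup>2 + A\<^sup>2"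
      using \<gamma>(1) t unfolding vertical_branch_def by blast
    have "\<gamma> t $ k = \<zeta>"
      using h c by (simp add: *(1) axis_def)
    moreover have "\<sigma> t = \<rho>"
      using h \<open>h \<noteq> 0\<close> by (simp add: \<sigma>_def *(1) inner_add_left inner_axis')
    ultimately show "\<gamma> t = c + \<sigma> t *\<^sub>R h + \<gamma> t $ k *\<^sub>R e\<^sub>k" "\<gamma> t $ k > 0" "(\<gamma> t $ k)\<^sup>2 = (\<sigma> t)\<^sup>2 + A\<^sup>2"
      using * by simp_all
  qed
  have dz: "((\<lambda>t. \<gamma> t $ k) has_vector_derivative w) (at t within T)"
    unfolding w_def by (rule bounded_linear.has_vector_derivative [OF bounded_linear_vec_nth v(1)])
  have d\<sigma>: "(\<sigma> has_vector_derivative p) (at t within T)"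
  proof -
    have "((\<lambda>t. \<gamma> t - c) has_vector_derivative v) (at t within T)"
      using v(1) by (auto intro!: derivative_eq_intros)
    moreover have "bounded_linear (\<lambda>x. x \<bullet> h / (h \<bullet> h))"
      by (intro bounded_linear_compose [OF bounded_linear_divide] bounded_linear_inner_left)
    ultimately show ?thesis
      unfolding \<sigma>_def p_def using bounded_linear.has_vector_derivative by blast
  qed
  have "((\<lambda>t. c + \<sigma> t *\<^sub>R h + \<gamma> t $ k *\<^sub>R e\<^sub>k) has_vector_derivative p *\<^sub>R h + w *\<^sub>R e\<^sub>k) (at t within T)"
    using dz d\<sigma> unfolding has_real_derivative_iff_has_vector_derivative [symmetric]
    by (rule has_vector_derivative_combination [rotated])
  then have "(\<gamma> has_vector_derivative p *\<^sub>R h + w *\<^sub>R e\<^sub>k) (at t within T)"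
    using on_branch(1) by (rule has_vector_derivative_transform [OF \<gamma>(2), rotated])
  from vector_derivative_unique_within [OF \<gamma>(3) v(1) this]
  have v_eq: "v = p *\<^sub>R h + w *\<^sub>R e\<^sub>k" .
  have "((\<lambda>t. (\<gamma> t $ k)\<^sup>2 - (\<sigma> t)\<^sup>2) has_vector_derivative 2 * \<gamma> t $ k * w - 2 * \<sigma> t * p) (at t within T)"
    using dz d\<sigma> unfolding has_real_derivative_iff_has_vector_derivative [symmetric]
    by (auto intro!: derivative_eq_intros)
  moreover have "((\<lambda>t. (\<gamma> t $ k)\<^sup>2 - (\<sigma> t)\<^sup>2) has_vector_derivative 0) (at t within T)"
    by (rule has_vector_derivative_transform [OF \<gamma>(2) _ has_vector_derivative_const [of "A\<^sup>2"]])
      (simp add: on_branch(3))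
  ultimately have "2 * \<gamma> t $ k * w - 2 * \<sigma> t * p = 0"
    by (rule vector_derivative_unique_within [OF \<gamma>(3)])
  then have zw: "\<gamma> t $ k * w = \<sigma> t * p" by simp
  note z = on_branch(2,3) [OF \<gamma>(2)]
  have "p \<noteq> 0" using zw z(1) v(2) v_eq by auto
  have "(\<gamma> t $ k)\<^sup>2 * w\<^sup>2 = (\<sigma> t)\<^sup>2 * p\<^sup>2"
    using zw by (metis power_mult_distrib)
  also have "\<dots> < (\<gamma> t $ k)\<^sup>2 * p\<^sup>2"
    using z \<open>p \<noteq> 0\<close> \<open>A > 0\<close> by (intro mult_strict_right_mono) auto
  finally have "w\<^sup>2 < p\<^sup>2" using z(1) by simp
  with v_eq that show ?thesis by blast
qed

lemma span_timelike:
  assumes "h $ k = 0" "gap h = 1" "x $ k > 0" "w\<^sup>2 < p\<^sup>2"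
  shows "\<g> x (p *\<^sub>R h + w *\<^sub>R e\<^sub>k) (p *\<^sub>R h + w *\<^sub>R e\<^sub>k) < 0"
proof -
  have "(p *\<^sub>R h + w *\<^sub>R e\<^sub>k) $ k = w" using assms by (simp add: axis_def)
  then show ?thesis using assms by (simp add: metric_diag gap_scaleR divide_neg_pos)
qed

lemma vertical_branch_subset: "c $ k = 0 \<Longrightarrow> h $ k = 0 \<Longrightarrow> vertical_branch c A h \<subseteq> \<H>"
  by (auto simp: vertical_branch_def half_space_def axis_def)

text \<open>
  From left to right, the normal form extends the geodesic to a full lifetime, and maximality makes the two agree.
  From right to left, an extension of the explicit geodesic has the same speed, hence a lifetime of the
  same length, and cannot be proper.
\<close>

lemma timelike_geodesic_iff_vertical_branch:
  "timelike_geodesic \<g> \<H> S \<longleftrightarrow>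
     (\<exists>c A h. c $ k = 0 \<and> h $ k = 0 \<and> gap h = 1 \<and> A > 0 \<and> S = vertical_branch c A h)"
proof
  assume "timelike_geodesic \<g> \<H> S"
  then obtain I \<gamma> where max: "maximal_geodesic_on \<g> \<H> I \<gamma>" and tl: "timelike_on \<g> I \<gamma>" and S: "S = \<gamma> ` I"
    unfolding timelike_geodesic_def by blast
  then have geo: "geodesic_on \<g> \<H> I \<gamma>" by (simp add: maximal_geodesic_on_def)
  then obtain t\<^sub>0 v where t\<^sub>0: "t\<^sub>0 \<in> I" and v: "(\<gamma> has_vector_derivative v) (at t\<^sub>0 within I)"
    unfolding geodesic_on_def by blast
  have "at t\<^sub>0 within I \<noteq> bot"
    using geo t\<^sub>0 unfolding geodesic_on_def by (intro interval_not_isolated) simp_all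
  then have "\<g> (\<gamma> t\<^sub>0) v v < 0"
    using tl [unfolded timelike_on_def Let_def, rule_format, OF t\<^sub>0]
    by (simp add: vector_derivative_within [OF _ v])
  then obtain \<omega> where \<omega>: "\<omega> > 0" "\<g> (\<gamma> t\<^sub>0) v v = - \<omega>\<^sup>2"
    by (intro that [of "sqrt (- \<g> (\<gamma> t\<^sub>0) v v)"]) auto
  obtain c A h s where nf: "c $ k = 0" "h $ k = 0" "gap h = 1" "A > 0" "I \<subseteq> lifetime \<omega> s"
    "\<And>t. t \<in> I \<Longrightarrow> \<gamma> t = branch_geodesic c A h \<omega> s t"
    by (rule timelike_geodesic_normal_form [OF geo t\<^sub>0 v \<omega>]) (rule that)
  have "\<not> I \<subset> lifetime \<omega> s"
    using max geodesic_branch_geodesic(1) [OF nf(1-4) \<omega>(1), of s] nf(6)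
    unfolding maximal_geodesic_on_def by auto
  with nf(5) have "I = lifetime \<omega> s" by blast
  then have "S = vertical_branch c A h"
    using nf(6) branch_geodesic_image [OF nf(4) \<omega>(1), of c h s] by (simp add: S cong: image_cong)
  with nf show "\<exists>c A h. c $ k = 0 \<and> h $ k = 0 \<and> gap h = 1 \<and> A > 0 \<and> S = vertical_branch c A h"
    by blast
next
  assume "\<exists>c A h. c $ k = 0 \<and> h $ k = 0 \<and> gap h = 1 \<and> A > 0 \<and> S = vertical_branch c A h"
  then obtain c A h where cAh: "c $ k = 0" "h $ k = 0" "gap h = 1" "A > 0" and S: "S = vertical_branch c A h"
    by blast
  define G J where "G = branch_geodesic c A h 1 0" and "J = lifetime 1 0"
  have geo: "geodesic_on \<g> \<H> J G"
    unfolding G_def J_def by (rule geodesic_branch_geodesic(1) [OF cAh]) simp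
  have energy: "\<g> (G t) (vector_derivative G (at t within J)) (vector_derivative G (at t within J)) = - 1\<^sup>2" if "t \<in> J" for t
    using that unfolding G_def J_def by (intro geodesic_branch_geodesic(2) [OF cAh]) simp_all
  have 0: "0 \<in> J" by (simp add: J_def lifetime_def)
  have "False" if "J \<subset> J'" "geodesic_on \<g> \<H> J' \<delta>" "\<forall>t\<in>J. \<delta> t = G t" for J' \<delta>
  proof -
    have "0 \<in> J'" using 0 that(1) by blast
    with that(2) obtain v where v: "(\<delta> has_vector_derivative v) (at 0 within J')"
      unfolding geodesic_on_def by blast
    then have "(\<delta> has_vector_derivative v) (at 0 within J)"
      using that(1) by (auto intro: has_vector_derivative_within_subset)
    from has_vector_derivative_transform [OF 0 _ this, of G]
    have "(G has_vector_derivative v) (at 0 within J)"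
      using that(3) by simp
    then have "vector_derivative G (at 0 within J) = v"
      using geo 0 by (intro vector_derivative_within interval_not_isolated) (auto simp: geodesic_on_def)
    then have "\<g> (\<delta> 0) v v = - 1\<^sup>2"
      using energy [OF 0] that(3) 0 by simp
    from timelike_geodesic_normal_form [OF that(2) \<open>0 \<in> J'\<close> v _ this]
    obtain s where "J' \<subseteq> lifetime 1 s" by (metis zero_less_one)
    with that(1) have "lifetime 1 0 \<subset> lifetime 1 s"
      unfolding J_def by blast
    then have "{- pi / 2 <..< pi / 2} \<subset> {s - pi / 2 <..< s + pi / 2}"
      by (simp add: lifetime_eq)
    then have "s - pi / 2 \<le> - pi / 2" "pi / 2 \<le> s + pi / 2" "s \<noteq> 0"
      by (auto simp: psubset_eq greaterThanLessThan_subseteq_greaterThanLessThan)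
    then show False by simp
  qed
  with geo have "maximal_geodesic_on \<g> \<H> J G"
    unfolding maximal_geodesic_on_def by blast
  moreover have "timelike_on \<g> J G"
    using energy by (simp add: timelike_on_def Let_def)
  moreover have "S = G ` J"
    using branch_geodesic_image [OF cAh(4), of 1 c h 0] by (simp add: S G_def J_def)
  ultimately show "timelike_geodesic \<g> \<H> S"
    unfolding timelike_geodesic_def by blast
qed

text \<open>
  A half-line is not contained in any lifetime. It suffices that the geodesic on the half-line is timelike at one
  time, which holds wherever its velocity is non-zero.
\<close>

lemma no_complete_ray_in_vertical_branch:
  assumes cAh: "c $ k = 0" "h $ k = 0" "gap h = 1" "A > 0" and R: "R \<subseteq> vertical_branch c A h"
  shows "\<not> complete_ray \<g> \<H> R"
proof
  assume "complete_ray \<g> \<H> R"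
  then obtain a \<delta> where geo: "geodesic_on \<g> \<H> {a..} \<delta>" and nonconst: "\<not> \<delta> constant_on {a..}"
    and \<delta>: "\<delta> ` {a..} = R"
    unfolding complete_ray_def by blast
  note a = geo [unfolded geodesic_on_def, THEN conjunct1] geo [unfolded geodesic_on_def, THEN conjunct2, THEN conjunct1]
  obtain \<delta>' where d\<delta>: "\<And>t. t \<in> {a..} \<Longrightarrow> (\<delta> has_vector_derivative \<delta>' t) (at t within {a..})"
    using geo unfolding geodesic_on_def by blast
  have "\<exists>t\<in>{a..}. \<delta>' t \<noteq> 0"
  proof (rule ccontr)
    assume "\<not> (\<exists>t\<in>{a..}. \<delta>' t \<noteq> 0)"
    then have "(\<delta> has_vector_derivative 0) (at t within {a..})" if "t \<in> {a..}" for t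
      using d\<delta> [OF that] that by auto
    then have "\<delta> t = \<delta> a" if "t \<in> {a..}" for t
      using zero_derivative_imp_const [OF a(1) _ that, of \<delta> a] by simp
    then show False using nonconst unfolding constant_on_def by blast
  qed
  then obtain t\<^sub>0 where t\<^sub>0: "t\<^sub>0 \<in> {a..}" "\<delta>' t\<^sub>0 \<noteq> 0" by blast
  have "\<delta> ` {a..} \<subseteq> vertical_branch c A h" using \<delta> R by simp
  from vertical_branch_velocity [OF cAh(2,3,1,4) this t\<^sub>0(1) interval_not_isolated [OF a t\<^sub>0(1)] d\<delta> [OF t\<^sub>0(1)] t\<^sub>0(2)]
  obtain p w where "\<delta>' t\<^sub>0 = p *\<^sub>R h + w *\<^sub>R e\<^sub>k" "w\<^sup>2 < p\<^sup>2" .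
  moreover have "\<delta> t\<^sub>0 $ k > 0" using geo t\<^sub>0 by (auto simp: geodesic_on_def half_space_def)
  ultimately have "\<g> (\<delta> t\<^sub>0) (\<delta>' t\<^sub>0) (\<delta>' t\<^sub>0) < 0"
    using span_timelike [OF cAh(2,3)] by simp
  then obtain \<omega> where \<omega>: "\<omega> > 0" "\<g> (\<delta> t\<^sub>0) (\<delta>' t\<^sub>0) (\<delta>' t\<^sub>0) = - \<omega>\<^sup>2"
    by (intro that [of "sqrt (- \<g> (\<delta> t\<^sub>0) (\<delta>' t\<^sub>0) (\<delta>' t\<^sub>0))"]) auto
  obtain s where "{a..} \<subseteq> lifetime \<omega> s"
    by (rule timelike_geodesic_normal_form [OF geo t\<^sub>0(1) d\<delta> [OF t\<^sub>0(1)] \<omega>]) (rule that)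
  then have "max a (s + pi / (2 * \<omega>)) \<in> lifetime \<omega> s"
    by auto
  then show False
    unfolding lifetime_eq [OF \<omega>(1)] by simp
qed

end

section \<open>Hyperbolas in vertical planes\<close>

text \<open>
  In coordinates relative to a horizontal unit vector \<open>h\<^sub>0\<close> with \<open>gap h\<^sub>0 = m\<close> and the vertical unit vector, let
  \<open>(\<alpha>, \<beta>)\<close> and \<open>(\<beta>, - \<alpha>)\<close> be the axes of a hyperbola with semi-axes \<open>A\<close> and \<open>B\<close>. The two inequalities say that its
  asymptotes are timelike or lightlike, and \<open>m * B\<^sup>2 = A\<^sup>2\<close> that its eccentricity is the prescribed one. Adding
  the inequalities gives \<open>\<alpha>\<^sup>2 \<le> m\<^sup>2 \<alpha>\<^sup>2\<close>. This settles everything but the rectangular case \<open>m = 1\<close>, where both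
  asymptotes must be lightlike and \<open>\<beta> > 0\<close> rules out that the axes are exchanged.
\<close>

lemma vertical_axis_of_asymptotes:
  fixes A B \<alpha> \<beta> m :: real
  assumes "A > 0" "B > 0" "\<beta> > 0" "0 < m" "m \<le> 1" "m * B\<^sup>2 = A\<^sup>2"
    and plus: "(A * \<beta> - B * \<alpha>)\<^sup>2 \<le> m * (A * \<alpha> + B * \<beta>)\<^sup>2"
    and minus: "(A * \<beta> + B * \<alpha>)\<^sup>2 \<le> m * (A * \<alpha> - B * \<beta>)\<^sup>2"
  shows "\<alpha> = 0"
proof -
  have "A\<^sup>2 * \<beta>\<^sup>2 + B\<^sup>2 * \<alpha>\<^sup>2 \<le> m * (A\<^sup>2 * \<alpha>\<^sup>2 + B\<^sup>2 * \<beta>\<^sup>2)"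
    using plus minus by (simp add: power2_eq_square algebra_simps)
  also have "\<dots> = m * A\<^sup>2 * \<alpha>\<^sup>2 + (m * B\<^sup>2) * \<beta>\<^sup>2"
    by (simp add: algebra_simps)
  also have "\<dots> = m * (m * B\<^sup>2) * \<alpha>\<^sup>2 + A\<^sup>2 * \<beta>\<^sup>2"
    using \<open>m * B\<^sup>2 = A\<^sup>2\<close> by simp
  finally have le: "B\<^sup>2 * \<alpha>\<^sup>2 \<le> m\<^sup>2 * (B\<^sup>2 * \<alpha>\<^sup>2)"
    by (simp add: power2_eq_square algebra_simps)
  show ?thesis
  proof (cases "m = 1")
    case True
    then have "A = B"
      using assms by (metis mult_1 power2_eq_imp_eq less_imp_le)
    with plus minus True have "(B * \<beta> - B * \<alpha>)\<^sup>2 = (B * \<beta> + B * \<alpha>)\<^sup>2"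
      by (simp add: power2_commute add.commute)
    then have "B\<^sup>2 * (\<alpha> * \<beta>) = 0"
      by (simp add: power2_eq_square algebra_simps)
    with assms show ?thesis by simp
  next
    case False
    then have "m\<^sup>2 < 1"
      using \<open>0 < m\<close> \<open>m \<le> 1\<close> by (simp add: abs_square_less_1)
    with le have "\<not> B\<^sup>2 * \<alpha>\<^sup>2 > 0"
      using mult_strict_right_mono [of "m\<^sup>2" 1 "B\<^sup>2 * \<alpha>\<^sup>2"] by auto
    with \<open>B > 0\<close> show ?thesis
      by (metis mult_pos_pos zero_less_power zero_less_power2)
  qed
qed

context half_space_model
begin

lemma ecc_T_eq: "ecc_T X Y v = sqrt (1 + ((norm v)\<^sup>2 - (v $ k)\<^sup>2) / gap v)"
proof -
  have L2: "(L2_set (\<lambda>i. v $ i) T)\<^sup>2 = (\<Sum>i\<in>T. (v $ i)\<^sup>2)" for T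
    by (simp add: L2_set_def sum_nonneg)
  have "(norm v)\<^sup>2 = (\<Sum>i\<in>X. (v $ i)\<^sup>2) + (\<Sum>i\<in>Y. (v $ i)\<^sup>2) + (v $ k)\<^sup>2"
    using sum_split [of "\<lambda>i. (v $ i)\<^sup>2"] by (simp add: norm_vec_def L2_set_def sum_nonneg)
  then show ?thesis by (simp add: ecc_T_def Let_def L2 gap_def)
qed

lemma norm_span:
  assumes "h $ k = 0"
  shows "(norm (p *\<^sub>R h + w *\<^sub>R e\<^sub>k))\<^sup>2 = p\<^sup>2 * (norm h)\<^sup>2 + w\<^sup>2"
proof -
  have "h \<bullet> e\<^sub>k = 0" "e\<^sub>k \<bullet> h = 0" "e\<^sub>k \<bullet> (e\<^sub>k :: real ^ 'n) = 1"
    using assms by (simp_all add: inner_axis inner_axis')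
  then show ?thesis
    unfolding power2_norm_eq_inner
    by (simp add: inner_add_left inner_add_right power2_eq_square algebra_simps)
qed

lemma ecc_T_span:
  assumes "h $ k = 0" "p \<noteq> 0"
  shows "ecc_T X Y (p *\<^sub>R h + w *\<^sub>R e\<^sub>k) = sqrt (1 + (norm h)\<^sup>2 / gap h)"
proof -
  have "(p *\<^sub>R h + w *\<^sub>R e\<^sub>k) $ k = w" using assms by (simp add: axis_def)
  then show ?thesis
    using assms by (simp add: ecc_T_eq norm_span gap_scaleR)
qed

lemma gap_le_norm: "gap v \<le> (norm v)\<^sup>2"
proof -
  have "gap v \<le> (\<Sum>i\<in>Y. (v $ i)\<^sup>2)"
    by (simp add: gap_def sum_nonneg)
  also have "\<dots> \<le> (\<Sum>i\<in>UNIV. (v $ i)\<^sup>2)"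
    by (intro sum_mono2) auto
  also have "\<dots> = (norm v)\<^sup>2"
    by (simp add: norm_vec_def L2_set_def sum_nonneg)
  finally show ?thesis .
qed

text \<open>
  The transverse axis is vertical with semi-axis \<open>A\<close>; the conjugate semi-axis is \<open>A * norm h\<close>, where
  \<open>(norm h)\<^sup>2 = (\<parallel>u\<parallel>\<^sup>2 + \<parallel>v\<parallel>\<^sup>2) / (\<parallel>v\<parallel>\<^sup>2 - \<parallel>u\<parallel>\<^sup>2)\<close> because \<open>gap h = 1\<close>.
\<close>

lemma timelike_hyperbola_branch_vertical_branch:
  assumes cAh: "c $ k = 0" "h $ k = 0" "gap h = 1" "A > 0"
  shows "timelike_hyperbola_branch X Y k (vertical_branch c A h)"
proof -
  let ?S = "vertical_branch c A h"
  have "h \<noteq> 0" using cAh by (auto simp: gap_def)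
  define e where "e = sqrt (1 + (norm h)\<^sup>2)"
  have "hyperbola_branch c e ?S"
    unfolding hyperbola_branch_def
  proof (intro exI conjI)
    show "norm (e\<^sub>k :: real ^ 'n) = 1" "norm ((1 / norm h) *\<^sub>R h) = 1" "A > 0" "A * norm h > 0"
      using \<open>h \<noteq> 0\<close> \<open>A > 0\<close> by auto
    show "e\<^sub>k \<bullet> ((1 / norm h) *\<^sub>R h) = 0"
      using cAh by (simp add: inner_axis')
    have "A\<^sup>2 + (A * norm h)\<^sup>2 = A\<^sup>2 * (1 + (norm h)\<^sup>2)"
      by (simp add: algebra_simps power2_eq_square)
    then show "e = sqrt (A\<^sup>2 + (A * norm h)\<^sup>2) / A"
      using \<open>A > 0\<close> by (simp add: e_def real_sqrt_mult)
    show "?S = {c + s *\<^sub>R e\<^sub>k + t *\<^sub>R (1 / norm h) *\<^sub>R h |s t. 0 < s \<and> s\<^sup>2 / A\<^sup>2 - t\<^sup>2 / (A * norm h)\<^sup>2 = 1}"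
      (is "_ = ?R")
    proof (intro equalityI subsetI)
      fix x assume "x \<in> ?S"
      then obtain \<sigma> \<zeta> where x: "x = c + \<sigma> *\<^sub>R h + \<zeta> *\<^sub>R e\<^sub>k" "\<zeta> > 0" "\<zeta>\<^sup>2 = \<sigma>\<^sup>2 + A\<^sup>2"
        unfolding vertical_branch_def by blast
      have "x = c + \<zeta> *\<^sub>R e\<^sub>k + (\<sigma> * norm h) *\<^sub>R (1 / norm h) *\<^sub>R h"
        using \<open>h \<noteq> 0\<close> by (simp add: x(1))
      moreover have "\<zeta>\<^sup>2 / A\<^sup>2 - (\<sigma> * norm h)\<^sup>2 / (A * norm h)\<^sup>2 = 1"
        using \<open>h \<noteq> 0\<close> \<open>A > 0\<close> x(3) by (simp add: power_mult_distrib field_simps)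
      ultimately show "x \<in> ?R" using x(2) by blast
    next
      fix x assume "x \<in> ?R"
      then obtain s t where x: "x = c + s *\<^sub>R e\<^sub>k + t *\<^sub>R (1 / norm h) *\<^sub>R h" "s > 0"
        "s\<^sup>2 / A\<^sup>2 - t\<^sup>2 / (A * norm h)\<^sup>2 = 1" by blast
      have "x = c + (t / norm h) *\<^sub>R h + s *\<^sub>R e\<^sub>k"
        by (simp add: x(1))
      moreover have "s\<^sup>2 = (t / norm h)\<^sup>2 + A\<^sup>2"
        using \<open>h \<noteq> 0\<close> \<open>A > 0\<close> x(3) by (simp add: power_mult_distrib power_divide field_simps)
      ultimately show "x \<in> ?S" using x(2) unfolding vertical_branch_def by blast
    qed
  qed
  moreover have "e = ecc_T X Y v \<and> horizontal_part k v \<in> span {h} \<and> \<g> x v v < 0"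
    if x: "x \<in> ?S" and tangent: "tangent_vector ?S x v" for x v
  proof -
    have "v \<noteq> 0" and ex: "\<exists>\<gamma>. \<gamma> 0 = x \<and> (\<forall>\<^sub>F s in nhds 0. \<gamma> s \<in> ?S)
        \<and> (\<gamma> has_vector_derivative v) (at (0::real))"
      using tangent unfolding tangent_vector_def by simp_all
    from ex obtain \<gamma> where \<gamma>: "\<gamma> 0 = x \<and> (\<forall>\<^sub>F s in nhds 0. \<gamma> s \<in> ?S)
        \<and> (\<gamma> has_vector_derivative v) (at (0::real))" ..
    then have v: "(\<gamma> has_vector_derivative v) (at 0)" and "\<forall>\<^sub>F s in nhds 0. \<gamma> s \<in> ?S"
      by simp_all
    then obtain T where T: "open T" "0 \<in> T" "\<gamma> ` T \<subseteq> ?S"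
      unfolding eventually_nhds image_subset_iff by metis
    have "at 0 within T = at 0"
      using T(2,1) by (rule at_within_open)
    with v have "(\<gamma> has_vector_derivative v) (at 0 within T)" "at 0 within T \<noteq> bot"
      by simp_all
    from vertical_branch_velocity [OF cAh(2,3,1,4) T(3,2) this(2,1) \<open>v \<noteq> 0\<close>]
    obtain p w where pw: "v = p *\<^sub>R h + w *\<^sub>R e\<^sub>k" "w\<^sup>2 < p\<^sup>2" .
    have "p \<noteq> 0" using pw(2) by auto
    moreover have "x $ k > 0"
      using x vertical_branch_subset [OF cAh(1,2)] by (auto simp: half_space_def)
    moreover have "horizontal_part k v = p *\<^sub>R h"
      using cAh by (simp add: horizontal_part_def pw(1) axis_def)
    ultimately show ?thesis
      using span_timelike [OF cAh(2,3) _ pw(2)] ecc_T_span [OF cAh(2)] cAh(3)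
      by (simp add: pw(1) e_def span_base span_mul)
  qed
  moreover have "?S \<subseteq> \<H>"
    using cAh(1,2) by (rule vertical_branch_subset)
  moreover from this have "?S \<inter> half_space_boundary k = {}"
    by (auto simp: half_space_def half_space_boundary_def)
  moreover have "c \<in> half_space_boundary k"
    using cAh(1) by (simp add: half_space_boundary_def)
  ultimately show ?thesis
    unfolding timelike_hyperbola_branch_def by (intro conjI exI [of _ c] exI [of _ e] exI [of _ h]) simp_all
qed

text \<open>
  The hyperbolic parametrization supplies enough tangent vectors: two of them show that the plane of the
  hyperbola is vertical, the one at the vertex relates the eccentricity to the semi-axes, and
  their limits at the two ends are the asymptotic directions, to which \<open>vertical_axis_of_asymptotes\<close> applies.
\<close>

lemma vertical_branch_of_timelike_hyperbola_branch:
  assumes "timelike_hyperbola_branch X Y k S"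
  shows "\<exists>c A h. c $ k = 0 \<and> h $ k = 0 \<and> gap h = 1 \<and> A > 0 \<and> S = vertical_branch c A h"
proof -
  obtain c e l where "S \<subseteq> \<H>" "c $ k = 0" and hyp: "hyperbola_branch c e S"
    and tan: "\<And>x v. x \<in> S \<Longrightarrow> tangent_vector S x v \<Longrightarrow>
      e = ecc_T X Y v \<and> horizontal_part k v \<in> span {l} \<and> \<g> x v v < 0"
    using assms unfolding timelike_hyperbola_branch_def half_space_boundary_def by blast
  from hyp obtain a b A B where ab: "norm a = 1" "norm b = 1" "a \<bullet> b = 0" and "A > 0" "B > 0"
    and e: "e = sqrt (A\<^sup>2 + B\<^sup>2) / A"
    and S: "S = {c + s *\<^sub>R a + t *\<^sub>R b | s t. s > 0 \<and> s\<^sup>2 / A\<^sup>2 - t\<^sup>2 / B\<^sup>2 = 1}"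
    unfolding hyperbola_branch_def by blast
  \<comment> \<open>The velocity of the parametrization \<open>c + A cosh r a + B sinh r b\<close>.\<close>
  define \<tau> where "\<tau> r = (A * sinh r) *\<^sub>R a + (B * cosh r) *\<^sub>R b" for r
  have \<tau>: "e = ecc_T X Y (\<tau> r)" "horizontal_part k (\<tau> r) \<in> span {l}" "(\<tau> r $ k)\<^sup>2 < gap (\<tau> r)" for r
  proof -
    define \<Gamma> where "\<Gamma> r = c + (A * cosh r) *\<^sub>R a + (B * sinh r) *\<^sub>R b" for r
    have \<Gamma>: "\<Gamma> r \<in> S" for r
    proof -
      have "(A * cosh r)\<^sup>2 / A\<^sup>2 - (B * sinh r)\<^sup>2 / B\<^sup>2 = 1" "A * cosh r > 0"
        using \<open>A > 0\<close> \<open>B > 0\<close> by (simp_all add: power_mult_distrib cosh_square_eq)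
      then show ?thesis unfolding S \<Gamma>_def by blast
    qed
    have "\<tau> r \<bullet> b = B * cosh r"
      using ab by (simp add: \<tau>_def inner_add_left power2_norm_eq_inner [symmetric])
    then have "\<tau> r \<noteq> 0"
      using \<open>B > 0\<close> by (metis cosh_real_pos inner_zero_left less_irrefl mult_pos_pos)
    moreover have "((\<lambda>s. \<Gamma> (r + s)) has_vector_derivative \<tau> r) (at 0)"
      unfolding \<Gamma>_def \<tau>_def
      by (intro has_vector_derivative_combination) (auto intro!: derivative_eq_intros)
    ultimately have "tangent_vector S (\<Gamma> r) (\<tau> r)"
      unfolding tangent_vector_def using \<Gamma> by (intro conjI exI [of _ "\<lambda>s. \<Gamma> (r + s)"]) auto
    with tan [OF \<Gamma>] have "e = ecc_T X Y (\<tau> r)" "horizontal_part k (\<tau> r) \<in> span {l}" "\<g> (\<Gamma> r) (\<tau> r) (\<tau> r) < 0"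
      by auto
    moreover have "\<Gamma> r $ k > 0" using \<Gamma> \<open>S \<subseteq> \<H>\<close> by (auto simp: half_space_def)
    ultimately show "e = ecc_T X Y (\<tau> r)" "horizontal_part k (\<tau> r) \<in> span {l}" "(\<tau> r $ k)\<^sup>2 < gap (\<tau> r)"
      by (auto simp: metric_diag divide_less_0_iff)
  qed

  \<comment> \<open>The plane of the hyperbola is spanned by the vertical and one horizontal direction:
    \<open>b\<close> is tangent at the vertex and timelike, so it has a
    non-zero horizontal part, and that of \<open>a\<close> is parallel to it.\<close>
  define a\<^sub>h b\<^sub>h where "a\<^sub>h = horizontal_part k a" and "b\<^sub>h = horizontal_part k b"
  have a: "a = a\<^sub>h + a $ k *\<^sub>R e\<^sub>k" and b: "b = b\<^sub>h + b $ k *\<^sub>R e\<^sub>k"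
    by (simp_all add: a\<^sub>h_def b\<^sub>h_def horizontal_part_def)
  have hk: "b\<^sub>h $ k = 0" "a\<^sub>h $ k = 0"
    by (simp_all add: a\<^sub>h_def b\<^sub>h_def horizontal_part_def axis_def)
  have lin: "horizontal_part k (p *\<^sub>R a + q *\<^sub>R b) = p *\<^sub>R a\<^sub>h + q *\<^sub>R b\<^sub>h" for p q
    by (simp add: a\<^sub>h_def b\<^sub>h_def horizontal_part_def algebra_simps)
  have "b\<^sub>h \<in> span {l}"
    using span_mul [OF \<tau>(2) [of 0], of "1 / B"] \<open>B > 0\<close> by (simp add: \<tau>_def b\<^sub>h_def horizontal_part_def scaleR_diff_right)
  moreover have "(A * sinh 1) *\<^sub>R a\<^sub>h + (B * cosh 1) *\<^sub>R b\<^sub>h \<in> span {l}"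
    using \<tau>(2) [of 1] by (simp add: \<tau>_def lin)
  ultimately have "(A * sinh 1) *\<^sub>R a\<^sub>h \<in> span {l}"
    by (metis add_diff_cancel_right' span_diff span_mul)
  from span_mul [OF this, of "1 / (A * sinh 1)"] have "a\<^sub>h \<in> span {l}"
    using \<open>A > 0\<close> by simp
  have "B\<^sup>2 * (b $ k)\<^sup>2 < B\<^sup>2 * gap b\<^sub>h"
    using \<tau>(3) [of 0] b gap_add_vertical [of b\<^sub>h "b $ k"] by (simp add: \<tau>_def gap_scaleR power_mult_distrib)
  then have gap_b: "(b $ k)\<^sup>2 < gap b\<^sub>h" using \<open>B > 0\<close> by simp
  then have "gap b\<^sub>h > 0" using zero_le_power2 [of "b $ k"] by linarith
  then have "b\<^sub>h \<noteq> 0" by (auto simp: gap_def)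
  define \<beta> where "\<beta> = norm b\<^sub>h"
  define h\<^sub>0 where "h\<^sub>0 = (1 / \<beta>) *\<^sub>R b\<^sub>h"
  have "\<beta> > 0" using \<open>b\<^sub>h \<noteq> 0\<close> by (simp add: \<beta>_def)
  have h\<^sub>0: "h\<^sub>0 $ k = 0" "norm h\<^sub>0 = 1" "b\<^sub>h = \<beta> *\<^sub>R h\<^sub>0"
    using hk \<open>b\<^sub>h \<noteq> 0\<close> by (simp_all add: h\<^sub>0_def \<beta>_def)
  obtain \<alpha> where \<alpha>: "a\<^sub>h = \<alpha> *\<^sub>R h\<^sub>0"
  proof -
    obtain x y where "a\<^sub>h = x *\<^sub>R l" "b\<^sub>h = y *\<^sub>R l"
      using \<open>a\<^sub>h \<in> span {l}\<close> \<open>b\<^sub>h \<in> span {l}\<close> by (auto simp: span_singleton)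
    moreover from this have "y \<noteq> 0" using \<open>b\<^sub>h \<noteq> 0\<close> by auto
    ultimately have "a\<^sub>h = (x / y * \<beta>) *\<^sub>R h\<^sub>0"
      using \<open>\<beta> > 0\<close> by (simp add: h\<^sub>0_def)
    with that show ?thesis .
  qed
  define m where "m = gap h\<^sub>0"
  have m: "0 < m" "m \<le> 1"
    using \<open>gap b\<^sub>h > 0\<close> \<open>\<beta> > 0\<close> gap_le_norm [of h\<^sub>0] h\<^sub>0(2)
    by (simp_all add: m_def h\<^sub>0(3) gap_scaleR zero_less_mult_iff)
  define a' b' where "a' = a $ k" and "b' = b $ k"
  have a: "a = \<alpha> *\<^sub>R h\<^sub>0 + a' *\<^sub>R e\<^sub>k" and b: "b = \<beta> *\<^sub>R h\<^sub>0 + b' *\<^sub>R e\<^sub>k"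
    using a b \<alpha> h\<^sub>0(3) by (simp_all add: a'_def b'_def)
  have "a' > 0"
  proof -
    have "c + A *\<^sub>R a + 0 *\<^sub>R b \<in> S"
      unfolding S using \<open>A > 0\<close> by (intro CollectI exI conjI refl) auto
    then have "(c + A *\<^sub>R a + 0 *\<^sub>R b) $ k > 0" using \<open>S \<subseteq> \<H>\<close> unfolding half_space_def by blast
    then show ?thesis using \<open>A > 0\<close> \<open>c $ k = 0\<close> by (simp add: a'_def zero_less_mult_iff)
  qed

  \<comment> \<open>An orthonormal pair in the plane is determined by one of its vectors up to orientation.\<close>
  have unit: "\<alpha>\<^sup>2 + a'\<^sup>2 = 1" "\<beta>\<^sup>2 + b'\<^sup>2 = 1"
    using norm_span [OF h\<^sub>0(1), of \<alpha> a'] norm_span [OF h\<^sub>0(1), of \<beta> b'] ab h\<^sub>0(2) by (simp_all flip: a b)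
  have orth: "\<alpha> * \<beta> + a' * b' = 0"
  proof -
    have "e\<^sub>k \<bullet> (e\<^sub>k :: real ^ 'n) = 1" "e\<^sub>k \<bullet> h\<^sub>0 = 0" "h\<^sub>0 \<bullet> e\<^sub>k = 0" "h\<^sub>0 \<bullet> h\<^sub>0 = 1"
      using h\<^sub>0(1,2) by (simp_all add: inner_axis inner_axis' norm_eq_1)
    then show ?thesis
      using ab(3) unfolding a b by (simp add: inner_add_left inner_add_right algebra_simps)
  qed
  have "a'\<^sup>2 = \<beta>\<^sup>2"
  proof -
    have "a'\<^sup>2 * b'\<^sup>2 = \<alpha>\<^sup>2 * \<beta>\<^sup>2"
      using orth by (metis add_eq_0_iff power2_minus power_mult_distrib)
    then have "a'\<^sup>2 * (1 - \<beta>\<^sup>2) = (1 - a'\<^sup>2) * \<beta>\<^sup>2"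
      using unit by (metis add_diff_cancel_left' add_diff_cancel_right')
    then show ?thesis by (simp add: algebra_simps)
  qed
  then have a': "a' = \<beta>"
    using \<open>a' > 0\<close> \<open>\<beta> > 0\<close> by (simp add: power2_eq_iff_nonneg)
  with orth \<open>\<beta> > 0\<close> have b': "b' = - \<alpha>"
    by (metis add.commute add_eq_0_iff distrib_left mult.commute mult_eq_0_iff less_irrefl)

  \<comment> \<open>The velocity at the vertex has a non-zero multiple of \<open>h\<^sub>0\<close> as its horizontal part, so that \<open>ecc_T\<close> is \<open>sqrt (1 + 1 / m)\<close> there.\<close>
  have mB: "m * B\<^sup>2 = A\<^sup>2"
  proof -
    have "\<tau> 0 = (B * \<beta>) *\<^sub>R h\<^sub>0 + (B * b') *\<^sub>R e\<^sub>k"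
      by (simp add: \<tau>_def b algebra_simps)
    then have "sqrt (A\<^sup>2 + B\<^sup>2) / A = sqrt (1 + 1 / m)"
      using \<tau>(1) [of 0] ecc_T_span [OF h\<^sub>0(1), of "B * \<beta>" "B * b'"] \<open>B > 0\<close> \<open>\<beta> > 0\<close>
      by (simp add: e h\<^sub>0(2) m_def)
    then have "(sqrt (A\<^sup>2 + B\<^sup>2) / A)\<^sup>2 = (sqrt (1 + 1 / m))\<^sup>2"
      by simp
    then have "(A\<^sup>2 + B\<^sup>2) / A\<^sup>2 = 1 + 1 / m"
      using m by (simp add: power_divide)
    then show ?thesis using m \<open>A > 0\<close> by (simp add: field_simps)
  qed

  \<comment> \<open>The timelike inequality for \<open>\<tau> r\<close>, divided by \<open>(cosh r)\<^sup>2\<close>; letting \<open>r\<close> tend to \<open>\<plusminus>\<infinity>\<close>, it passes to the asymptotes.\<close>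
  have timelike: "(A * \<beta> * tanh r - B * \<alpha>)\<^sup>2 \<le> m * (A * \<alpha> * tanh r + B * \<beta>)\<^sup>2" for r
  proof -
    have "\<tau> r = (A * sinh r * \<alpha> + B * cosh r * \<beta>) *\<^sub>R h\<^sub>0 + (A * sinh r * \<beta> - B * cosh r * \<alpha>) *\<^sub>R e\<^sub>k"
      unfolding \<tau>_def a b a' b' by (simp add: algebra_simps)
    moreover from this have "\<tau> r $ k = A * sinh r * \<beta> - B * cosh r * \<alpha>"
      using h\<^sub>0(1) by (simp add: axis_def)
    moreover from calculation(1) have "gap (\<tau> r) = m * (A * sinh r * \<alpha> + B * cosh r * \<beta>)\<^sup>2"
      by (simp only: gap_add_vertical gap_scaleR m_def mult.commute)
    ultimately have "(A * sinh r * \<beta> - B * cosh r * \<alpha>)\<^sup>2 \<le> m * (A * sinh r * \<alpha> + B * cosh r * \<beta>)\<^sup>2"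
      using \<tau>(3) [of r] by (simp only: less_imp_le)
    also have "A * sinh r * \<beta> - B * cosh r * \<alpha> = cosh r * (A * \<beta> * tanh r - B * \<alpha>)"
      by (simp add: tanh_def algebra_simps)
    also have "A * sinh r * \<alpha> + B * cosh r * \<beta> = cosh r * (A * \<alpha> * tanh r + B * \<beta>)"
      by (simp add: tanh_def algebra_simps)
    finally show ?thesis
      using cosh_real_pos [of r] by (simp add: power_mult_distrib)
  qed
  have asymptote: "(A * \<beta> * \<epsilon> - B * \<alpha>)\<^sup>2 \<le> m * (A * \<alpha> * \<epsilon> + B * \<beta>)\<^sup>2"
    if "F \<noteq> bot" "(tanh \<longlongrightarrow> \<epsilon>) F" for F and \<epsilon> :: real
  proof -
    have "((\<lambda>r. (A * \<beta> * T r - B * \<alpha>)\<^sup>2) \<longlongrightarrow> (A * \<beta> * \<epsilon> - B * \<alpha>)\<^sup>2) F"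
      "((\<lambda>r. m * (A * \<alpha> * T r + B * \<beta>)\<^sup>2) \<longlongrightarrow> m * (A * \<alpha> * \<epsilon> + B * \<beta>)\<^sup>2) F"
      if "(T \<longlongrightarrow> \<epsilon>) F" for T
      by (intro tendsto_intros that)+
    from tendsto_le [OF that(1) this(2,1) [OF that(2)]] timelike show ?thesis
      by simp
  qed
  have "(A * \<beta> * 1 - B * \<alpha>)\<^sup>2 \<le> m * (A * \<alpha> * 1 + B * \<beta>)\<^sup>2"
    by (rule asymptote [OF trivial_limit_at_top_linorder tanh_real_at_top])
  moreover have "(A * \<beta> * (-1) - B * \<alpha>)\<^sup>2 \<le> m * (A * \<alpha> * (-1) + B * \<beta>)\<^sup>2"
    by (rule asymptote [OF trivial_limit_at_bot_linorder tanh_real_at_bot])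
  moreover have "(- (A * \<beta>) - B * \<alpha>)\<^sup>2 = (A * \<beta> + B * \<alpha>)\<^sup>2" "(- (A * \<alpha>) + B * \<beta>)\<^sup>2 = (A * \<alpha> - B * \<beta>)\<^sup>2"
    by (simp_all add: power2_eq_square algebra_simps)
  ultimately have "\<alpha> = 0"
    using vertical_axis_of_asymptotes [OF \<open>A > 0\<close> \<open>B > 0\<close> \<open>\<beta> > 0\<close> m mB] by simp
  then have "\<beta> = 1"
    using unit(2) b' \<open>\<beta> > 0\<close> by (simp add: power2_eq_1_iff)
  have ab_eq: "a = e\<^sub>k" "b = h\<^sub>0"
    unfolding a b a' b' \<open>\<alpha> = 0\<close> \<open>\<beta> = 1\<close> by simp_all

  define h where "h = (1 / sqrt m) *\<^sub>R h\<^sub>0"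
  have h: "h $ k = 0" "gap h = 1"
    using h\<^sub>0(1) m by (simp_all add: h_def gap_scaleR power_divide flip: m_def)
  have B: "B\<^sup>2 = A\<^sup>2 / m" using mB m by (simp add: field_simps)
  have "S = vertical_branch c A h"
    unfolding S ab_eq
  proof (intro equalityI subsetI)
    fix x assume "x \<in> {c + s *\<^sub>R e\<^sub>k + t *\<^sub>R h\<^sub>0 |s t. 0 < s \<and> s\<^sup>2 / A\<^sup>2 - t\<^sup>2 / B\<^sup>2 = 1}"
    then obtain s t where x: "x = c + s *\<^sub>R e\<^sub>k + t *\<^sub>R h\<^sub>0" "s > 0" "s\<^sup>2 / A\<^sup>2 - t\<^sup>2 / B\<^sup>2 = 1"
      by blast
    have "x = c + (t * sqrt m) *\<^sub>R h + s *\<^sub>R e\<^sub>k"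
      using m by (simp add: x(1) h_def)
    moreover have "s\<^sup>2 = (t * sqrt m)\<^sup>2 + A\<^sup>2"
      using x(3) m \<open>A > 0\<close> unfolding B by (simp add: power_mult_distrib field_simps)
    ultimately show "x \<in> vertical_branch c A h"
      using x(2) unfolding vertical_branch_def by blast
  next
    fix x assume "x \<in> vertical_branch c A h"
    then obtain \<sigma> \<zeta> where x: "x = c + \<sigma> *\<^sub>R h + \<zeta> *\<^sub>R e\<^sub>k" "\<zeta> > 0" "\<zeta>\<^sup>2 = \<sigma>\<^sup>2 + A\<^sup>2"
      unfolding vertical_branch_def by blast
    have "x = c + \<zeta> *\<^sub>R e\<^sub>k + (\<sigma> / sqrt m) *\<^sub>R h\<^sub>0"
      by (simp add: x(1) h_def)
    moreover have "\<zeta>\<^sup>2 / A\<^sup>2 - (\<sigma> / sqrt m)\<^sup>2 / B\<^sup>2 = 1"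
      using x(3) m \<open>A > 0\<close> unfolding B by (simp add: power_divide field_simps)
    ultimately show "x \<in> {c + s *\<^sub>R e\<^sub>k + t *\<^sub>R h\<^sub>0 |s t. 0 < s \<and> s\<^sup>2 / A\<^sup>2 - t\<^sup>2 / B\<^sup>2 = 1}"
      using x(2) by blast
  qed
  with \<open>c $ k = 0\<close> h \<open>A > 0\<close> show ?thesis by blast
qed

end

section \<open>The classification\<close>

theorem proposition4p5:
  fixes p q :: nat and X Y :: "'n::finite set" and k :: 'n
  assumes "p \<ge> 1"
    and "card X = p - 1" and "card Y = q"
    and "X \<inter> Y = {}" and "k \<notin> X \<union> Y" and "X \<union> Y \<union> {k} = UNIV"
  shows "(\<forall>S. timelike_geodesic (half_space_metric X Y k) (half_space k) S \<longleftrightarrow>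
              timelike_hyperbola_branch X Y k S) \<and>
         (\<forall>S. timelike_geodesic (half_space_metric X Y k) (half_space k) S \<longrightarrow>
              incomplete_on_both_sides (half_space_metric X Y k) (half_space k) S)"
proof -
  interpret half_space_model X Y k
    using assms by unfold_locales
  have "timelike_geodesic \<g> \<H> S \<longleftrightarrow> timelike_hyperbola_branch X Y k S" for S
    using timelike_geodesic_iff_vertical_branch timelike_hyperbola_branch_vertical_branch
      vertical_branch_of_timelike_hyperbola_branch by metis
  moreover have "incomplete_on_both_sides \<g> \<H> S" if S: "timelike_geodesic \<g> \<H> S" for S
  proof -
    obtain c A h where "c $ k = 0" "h $ k = 0" "gap h = 1" "A > 0" "S = vertical_branch c A h"
      using S timelike_geodesic_iff_vertical_branch by blast
    then have "\<not> complete_ray \<g> \<H> R" if "R \<subseteq> S" for R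
      using no_complete_ray_in_vertical_branch that by blast
    then show ?thesis
      unfolding incomplete_on_both_sides_def by (metis Int_lower1 image_mono)
  qed
  ultimately show ?thesis by blast
qed

end
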